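(* Let $\{T_1,T_2\}$ be a dual pair of symmetric contractions in $\mathfrak H=\mathfrak H_1\oplus\mathfrak H_2$, with blocks $T_{11}=T_{11}^*$, $T_{21}=VD_{T_{11}}$, $T_{12}=D_{T_{11}}U$. Let $Q$ be the closure of $Q_0=D_{V^*}^{-1}(I-VU)D_U^{-1}$, $\varphi_1:=\arccos(\|Q\|^{-1})$, and $\varphi\in[\varphi_1,\pi/2]$, $\varphi>0$. Let $K\in[\mathcal H_1,\mathcal H_2]$ be a bounded (not necessarily contractive) operator and $T_K=\begin{pmatrix}T_{11}&T_{12}\\ T_{21}&-VT_{11}U+D_{V^*}KD_U\end{pmatrix}$. Put $$S^{\pm}=(S^{\pm}_{ij})_{i,j=1}^2:=I-T_KT_K^*\pm i\cot\varphi\,(T_K-T_K^* ),\qquad G^{\pm}=(G^{\pm}_{ij})_{i,j=1}^2:=I-T_K^*T_K\pm i\cot\varphi\,(T_K-T_K^* ),$$ block matrices with respect to $\mathfrak H=\mathfrak H_1\oplus\mathfrak H_2$. Then $S_{11}:=S_{11}^+=S_{11}^-\ge0$, $G_{11}:=G_{11}^+=G_{11}^-\ge0$, and: (i) $\mathrm{ran}(S_{11}^{1/2})\supset\mathrm{ran}(S_{12}^{\pm})$ and $\mathrm{ran}(G_{11}^{1/2})\supset\mathrm{ran}(G_{12}^{\pm})$; consequently the operators $S_{11}^{-1/2}S_{12}^{\pm}$ and $G_{11}^{-1/2}G_{12}^{\pm}$ are well defined and bounded; (ii) the following identities hold (upper signs together, lower signs together): $$\sin^2\varphi\,\bigl[S_{22}^{\pm}-(S_{11}^{-1/2}S_{12}^{\pm})^*(S_{11}^{-1/2}S_{12}^{\pm})\bigr]=D_{V^*}\bigl[I-(K\sin\varphi\pm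 iQ\cos\varphi)(K^*\sin\varphi\mp iQ^*\cos\varphi)\bigr]D_{V^*},$$ $$\sin^2\varphi\,\bigl[G_{22}^{\pm}-(G_{11}^{-1/2}G_{12}^{\pm})^*(G_{11}^{-1/2}G_{12}^{\pm})\bigr]=D_U\bigl[I-(K^*\sin\varphi\mp iQ^*\cos\varphi)(K\sin\varphi\pm iQ\cos\varphi)\bigr]D_U.$$
   Context: Hilbert spaces are complex and separable; $[\mathfrak H,\mathfrak K]$ denotes bounded operators from $\mathfrak H$ to $\mathfrak K$. For a contraction $X$, $D_X:=(I-X^*X)^{1/2}$. A dual pair of symmetric contractions in $\mathfrak H=\mathfrak H_1\oplus\mathfrak H_2$ is a pair of contractions $T_1,T_2\in[\mathfrak H_1,\mathfrak H]$ with $(T_1f,g)=(f,T_2g)$ and $(T_jf,g)=(f,T_jg)$ for $f,g\in\mathfrak H_1$. Equivalently $T_1=\binom{T_{11}}{T_{21}}$, $T_2=\binom{T_{11}}{T_{12}^*}$ with $T_{11}=T_{11}^*\in[\mathfrak H_1]$, $T_{21}=VD_{T_{11}}$, $T_{12}=D_{T_{11}}U$, where $V\in[\mathfrak H_1,\mathfrak H_2]$, $U\in[\mathfrak H_2,\mathfrak H_1]$ are the contractions uniquely determined by additionally requiring $\ker V\supset\ker D_{T_{11}}$ and $\ker U^*\supset\ker D_{T_{11}}$. $\mathcal H_1:=\overline{\mathrm{ran}}\,D_U$ and $\mathcal H_2:=\overline{\mathrm{ran}}\,D_{V^*}$ (subspaces of $\mathfrak H_2$). Conventions on $Q_0$: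 $Q_0$ is called bounded if there is $Q\in[\mathcal H_1,\mathcal H_2]$ with $I-VU=D_{V^*}QD_U$ on $\mathfrak H_2$; then $Q$ is unique and is the closure of $Q_0$. Otherwise $\|Q\|^{-1}:=0$, so $\varphi_1=\pi/2$; for $\varphi=\pi/2$, $Q\cos\varphi$ is read as $0$. If $Q_0$ is bounded and $\mathcal H_1=\{0\}$ or $\mathcal H_2=\{0\}$, then $\varphi_1:=0$. For a nonnegative operator $A$ and an operator $B$ with $\mathrm{ran}\,B\subset\mathrm{ran}\,A^{1/2}$, $A^{-1/2}B$ denotes the operator $S$ with $A^{1/2}S=B$ and $\mathrm{ran}\,S\subset\overline{\mathrm{ran}}\,A$. Block $X_{ij}$ maps $\mathfrak H_j$ to $\mathfrak H_i$. *)

theory Defs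
  imports "HOL-Analysis.Analysis"
begin

section \<open>Complex separable Hilbert spaces\<close>

text \<open>
  The complex structure sits on top of the real one: the real inner product is the real part of the
  complex one, so norm, topology and completeness are those of the library. The complex inner
  product is linear in its first argument. Separability is second countability.
\<close>

class complex_inner = real_inner +
  fixes scaleC :: "complex \<Rightarrow> 'a \<Rightarrow> 'a" (infixr "*\<^sub>C" 75)
    and cinner :: "'a \<Rightarrow> 'a \<Rightarrow> complex"
  assumes scaleC_add_right: "c *\<^sub>C (x + y) = c *\<^sub>C x + c *\<^sub>C y"
    and scaleC_add_left: "(c + d) *\<^sub>C x = c *\<^sub>C x + d *\<^sub>C x"
    and scaleC_scaleC: "c *\<^sub>C (d *\<^sub>C x) = (c * d) *\<^sub>C x"
    and scaleR_scaleC: "r *\<^sub>R x = complex_of_real r *\<^sub>C x"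
    and cinner_commute: "cinner x y = cnj (cinner y x)"
    and cinner_add_left: "cinner (x + y) z = cinner x z + cinner y z"
    and cinner_scaleC_left: "cinner (c *\<^sub>C x) y = c * cinner x y"
    and inner_eq_Re_cinner: "inner x y = Re (cinner x y)"

class complex_hilbert = complex_inner + complete_space + second_countable_topology

text \<open>The orthogonal sum of two spaces is their product.\<close>

instantiation prod :: (complex_inner, complex_inner) complex_inner
begin

definition "scaleC c p = (c *\<^sub>C fst p, c *\<^sub>C snd p)"

definition "cinner p q = cinner (fst p) (fst q) + cinner (snd p) (snd q)"

instance
proof
  fix x y z :: "'a \<times> 'b" and c d :: complex and r :: real
  show "c *\<^sub>C (x + y) = c *\<^sub>C x + c *\<^sub>C y"
    by (simp add: scaleC_prod_def scaleC_add_right)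
  show "(c + d) *\<^sub>C x = c *\<^sub>C x + d *\<^sub>C x"
    by (simp add: scaleC_prod_def scaleC_add_left)
  show "c *\<^sub>C (d *\<^sub>C x) = (c * d) *\<^sub>C x"
    by (simp add: scaleC_prod_def scaleC_scaleC)
  show "r *\<^sub>R x = complex_of_real r *\<^sub>C x"
    by (simp add: scaleC_prod_def scaleR_prod_def scaleR_scaleC)
  show "cinner x y = cnj (cinner y x)"
    by (simp add: cinner_prod_def cinner_commute[of "fst x"] cinner_commute[of "snd x"])
  show "cinner (x + y) z = cinner x z + cinner y z"
    by (simp add: cinner_prod_def cinner_add_left)
  show "cinner (c *\<^sub>C x) y = c * cinner x y"
    by (simp add: cinner_prod_def scaleC_prod_def cinner_scaleC_left distrib_left)
  show "inner x y = Re (cinner x y)"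
    by (simp add: cinner_prod_def inner_prod_def inner_eq_Re_cinner)
qed

end

instance prod :: (complex_hilbert, complex_hilbert) complex_hilbert ..

section \<open>Bounded operators\<close>

definition bounded_clinear :: "('a::complex_hilbert \<Rightarrow> 'b::complex_hilbert) \<Rightarrow> bool" where
  "bounded_clinear A \<longleftrightarrow> bounded_linear A \<and> (\<forall>c x. A (c *\<^sub>C x) = c *\<^sub>C A x)"

definition cadjoint :: "('a::complex_hilbert \<Rightarrow> 'b::complex_hilbert) \<Rightarrow> 'b \<Rightarrow> 'a" where
  "cadjoint A = (THE B. \<forall>x y. cinner (A x) y = cinner x (B y))"

definition nonneg_op :: "('a::complex_hilbert \<Rightarrow> 'a) \<Rightarrow> bool" where
  "nonneg_op A \<longleftrightarrow> bounded_clinear A \<and> (\<forall>x. cinner (A x) x \<in> \<real> \<and> 0 \<le> Re (cinner (A x) x))"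

definition op_sqrt :: "('a::complex_hilbert \<Rightarrow> 'a) \<Rightarrow> 'a \<Rightarrow> 'a" where
  "op_sqrt A = (THE B. nonneg_op B \<and> (\<forall>x. B (B x) = A x))"

definition contraction :: "('a::complex_hilbert \<Rightarrow> 'b::complex_hilbert) \<Rightarrow> bool" where
  "contraction A \<longleftrightarrow> bounded_clinear A \<and> onorm A \<le> 1"

definition defect_op :: "('a::complex_hilbert \<Rightarrow> 'b::complex_hilbert) \<Rightarrow> 'a \<Rightarrow> 'a" where
  "defect_op X = op_sqrt (\<lambda>x. x - cadjoint X (X x))"

definition ker_op :: "('a::complex_hilbert \<Rightarrow> 'b::complex_hilbert) \<Rightarrow> 'a set" where
  "ker_op A = {x. A x = 0}"

text \<open>
  Bounded operators from a closed subspace \<open>S\<close> of one space to a closed subspace \<open>T\<close> of another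
  are represented by their extension by zero to the orthogonal complement of \<open>S\<close>. The extension
  has the same norm, and the adjoint of the extension is the extension (from \<open>T\<close>) of the adjoint.
\<close>

definition ops_between ::
  "'a::complex_hilbert set \<Rightarrow> 'b::complex_hilbert set \<Rightarrow> ('a \<Rightarrow> 'b) set" where
  "ops_between S T = {A. bounded_clinear A \<and> range A \<subseteq> T \<and>
     (\<forall>x. (\<forall>s\<in>S. cinner x s = 0) \<longrightarrow> A x = 0)}"

text \<open>\<open>is_inv_sqrt_mult A B R\<close> says that \<open>R\<close> is the operator written $A^{-1/2}B$.\<close>

definition is_inv_sqrt_mult ::
  "('b::complex_hilbert \<Rightarrow> 'b) \<Rightarrow> ('a::complex_hilbert \<Rightarrow> 'b) \<Rightarrow> ('a \<Rightarrow> 'b) \<Rightarrow> bool" where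
  "is_inv_sqrt_mult A B R \<longleftrightarrow>
     (\<forall>x. op_sqrt A (R x) = B x) \<and> range R \<subseteq> closure (range A)"

definition inv_sqrt_mult ::
  "('b::complex_hilbert \<Rightarrow> 'b) \<Rightarrow> ('a::complex_hilbert \<Rightarrow> 'b) \<Rightarrow> 'a \<Rightarrow> 'b" where
  "inv_sqrt_mult A B = (THE R. is_inv_sqrt_mult A B R)"

section \<open>Block operators on an orthogonal sum\<close>

definition block_op ::
  "('a::complex_hilbert \<Rightarrow> 'a) \<Rightarrow> ('b::complex_hilbert \<Rightarrow> 'a) \<Rightarrow> ('a \<Rightarrow> 'b) \<Rightarrow> ('b \<Rightarrow> 'b)
    \<Rightarrow> 'a \<times> 'b \<Rightarrow> 'a \<times> 'b" where
  "block_op A11 A12 A21 A22 = (\<lambda>(x, y). (A11 x + A12 y, A21 x + A22 y))"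

definition block11 ::
  "('a::complex_hilbert \<times> 'b::complex_hilbert \<Rightarrow> 'a \<times> 'b) \<Rightarrow> 'a \<Rightarrow> 'a" where
  "block11 X = (\<lambda>x. fst (X (x, 0)))"

definition block12 ::
  "('a::complex_hilbert \<times> 'b::complex_hilbert \<Rightarrow> 'a \<times> 'b) \<Rightarrow> 'b \<Rightarrow> 'a" where
  "block12 X = (\<lambda>y. fst (X (0, y)))"

definition block22 ::
  "('a::complex_hilbert \<times> 'b::complex_hilbert \<Rightarrow> 'a \<times> 'b) \<Rightarrow> 'b \<Rightarrow> 'b" where
  "block22 X = (\<lambda>y. snd (X (0, y)))"

section \<open>Dual pairs of symmetric contractions\<close>

definition dual_pair_symm_contractions ::
  "('a::complex_hilbert \<Rightarrow> 'a \<times> 'b::complex_hilbert) \<Rightarrow> ('a \<Rightarrow> 'a \<times> 'b) \<Rightarrow> bool" where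
  "dual_pair_symm_contractions T1 T2 \<longleftrightarrow>
     contraction T1 \<and> contraction T2 \<and>
     (\<forall>f g. cinner (T1 f) (g, 0) = cinner (f, 0) (T2 g)) \<and>
     (\<forall>f g. cinner (T1 f) (g, 0) = cinner (f, 0) (T1 g)) \<and>
     (\<forall>f g. cinner (T2 f) (g, 0) = cinner (f, 0) (T2 g))"

text \<open>
  The subspaces $\mathcal H_1 = \overline{\mathrm{ran}}\, D_U$ and
  $\mathcal H_2 = \overline{\mathrm{ran}}\, D_{V^*}$.
\<close>

definition defect_space1 :: "('b::complex_hilbert \<Rightarrow> 'a::complex_hilbert) \<Rightarrow> 'b set" where
  "defect_space1 U = closure (range (defect_op U))"

definition defect_space2 :: "('a::complex_hilbert \<Rightarrow> 'b::complex_hilbert) \<Rightarrow> 'b set" where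
  "defect_space2 V = closure (range (defect_op (cadjoint V)))"

text \<open>
  The operator $Q_0 = D_{V^*}^{-1}(I - VU)D_U^{-1}$ is called bounded if $I - VU = D_{V^*} Q D_U$ for
  some bounded $Q$ from $\mathcal H_1$ to $\mathcal H_2$; this $Q$ is unique and is the closure of
  $Q_0$. If $Q_0$ is unbounded, the only admissible angle is $\pi/2$ and $Q\cos(\pi/2)$ is read
  as 0; the value 0 given to \<open>Q_op\<close> in that case serves this purpose only.
\<close>

definition is_Q ::
  "('b::complex_hilbert \<Rightarrow> 'a::complex_hilbert) \<Rightarrow> ('a \<Rightarrow> 'b) \<Rightarrow> ('b \<Rightarrow> 'b) \<Rightarrow> bool" where
  "is_Q U V Q \<longleftrightarrow> Q \<in> ops_between (defect_space1 U) (defect_space2 V) \<and>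
     (\<forall>h. h - V (U h) = defect_op (cadjoint V) (Q (defect_op U h)))"

definition Q0_bounded ::
  "('b::complex_hilbert \<Rightarrow> 'a::complex_hilbert) \<Rightarrow> ('a \<Rightarrow> 'b) \<Rightarrow> bool" where
  "Q0_bounded U V \<longleftrightarrow> (\<exists>Q. is_Q U V Q)"

definition Q_op ::
  "('b::complex_hilbert \<Rightarrow> 'a::complex_hilbert) \<Rightarrow> ('a \<Rightarrow> 'b) \<Rightarrow> 'b \<Rightarrow> 'b" where
  "Q_op U V = (if Q0_bounded U V then (THE Q. is_Q U V Q) else (\<lambda>_. 0))"

definition phi1 ::
  "('b::complex_hilbert \<Rightarrow> 'a::complex_hilbert) \<Rightarrow> ('a \<Rightarrow> 'b) \<Rightarrow> real" where
  "phi1 U V =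
    (if \<not> Q0_bounded U V then arccos 0
     else if defect_space1 U = {0} \<or> defect_space2 V = {0} then 0
     else arccos (inverse (onorm (Q_op U V))))"

end

theory Submission
  imports Defs
begin

text \<open>
  Put \<open>\<omega> = \<plusminus> i cot \<phi>\<close> and \<open>L = K + \<omega> Q\<close>. The relation \<open>I - V U = D\<^bsub>V*\<^esub> Q D\<^sub>U\<close> gives
  \<open>S\<^sub>1\<^sub>1 = A A*\<close> and \<open>S\<^sub>1\<^sub>2 = A Z\<close> with \<open>A = D\<^sub>T D\<^bsub>U*\<^esub>\<close>,
  \<open>Z = - (D\<^bsub>U*\<^esub> (T + \<omega>) V* + U L* D\<^bsub>V*\<^esub>)\<close>, where the range of \<open>Z\<close> is orthogonal to the kernel of
  \<open>A\<close>. Hence \<open>S\<^sub>1\<^sub>1\<^bsup>-1/2\<^esup> S\<^sub>1\<^sub>2\<close> has the same Gram operator as \<open>Z\<close>, and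
  \<open>S\<^sub>2\<^sub>2 - Z* Z = (1 - \<omega>\<^sup>2) D\<^bsub>V*\<^esub>\<^sup>2 - D\<^bsub>V*\<^esub> L L* D\<^bsub>V*\<^esub>\<close> is an algebraic identity. The statement for
  \<open>G\<close> is the one for \<open>S\<close> with \<open>U, V, K, Q, \<omega>\<close> replaced by \<open>V*, U*, K*, Q*, - \<omega>\<close>. Unbounded \<open>Q\<^sub>0\<close> forces
  \<open>\<omega> = 0\<close>, and then \<open>Q\<close> plays no role.
\<close>

section \<open>Complex inner product spaces\<close>

text \<open>The square root is built as a limit in the space of bounded operators, whose
  completeness rests on a \<open>banach\<close> codomain.\<close>

instance complex_hilbert \<subseteq> banach ..

lemma scaleC_zero_right [simp]: "c *\<^sub>C (0::'a::complex_inner) = 0"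
  using scaleC_add_right[of c 0 0] by simp

lemma scaleC_minus_right [simp]: "c *\<^sub>C (- x) = - (c *\<^sub>C (x::'a::complex_inner))"
  using scaleC_add_right[of c x "- x"] by (simp add: eq_neg_iff_add_eq_0 add.commute)

lemma scaleC_diff_right: "c *\<^sub>C (x - y) = c *\<^sub>C x - c *\<^sub>C (y::'a::complex_inner)"
  using scaleC_add_right[of c x "- y"] by simp

lemma scaleC_zero_left [simp]: "0 *\<^sub>C (x::'a::complex_inner) = 0"
  using scaleR_scaleC[of 0 x] by simp

lemma scaleC_one [simp]: "1 *\<^sub>C (x::'a::complex_inner) = x"
  using scaleR_scaleC[of 1 x] by simp

lemma scaleC_minus_left [simp]: "(- c) *\<^sub>C x = - (c *\<^sub>C (x::'a::complex_inner))"
  using scaleC_add_left[of c "- c" x] by (simp add: eq_neg_iff_add_eq_0 add.commute)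

lemma scaleC_diff_left: "(c - d) *\<^sub>C x = c *\<^sub>C x - d *\<^sub>C (x::'a::complex_inner)"
  using scaleC_add_left[of c "- d" x] by simp

lemma cinner_add_right: "cinner x (y + z) = cinner x y + cinner x (z::'a::complex_inner)"
  by (metis cinner_add_left cinner_commute complex_cnj_add)

lemma cinner_scaleC_right: "cinner x (c *\<^sub>C y) = cnj c * cinner x (y::'a::complex_inner)"
  by (metis cinner_commute cinner_scaleC_left complex_cnj_mult)

lemma cinner_zero_left [simp]: "cinner 0 (y::'a::complex_inner) = 0"
  using cinner_scaleC_left[of 0 0 y] by simp

lemma cinner_zero_right [simp]: "cinner (y::'a::complex_inner) 0 = 0"
  using cinner_scaleC_right[of y 0 0] by simp

lemma cinner_minus_left [simp]: "cinner (- x) y = - cinner x (y::'a::complex_inner)"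
  using cinner_scaleC_left[of "-1" x y] by simp

lemma cinner_minus_right [simp]: "cinner x (- y) = - cinner x (y::'a::complex_inner)"
  using cinner_scaleC_right[of x "-1" y] by simp

lemma cinner_diff_left: "cinner (x - y) z = cinner x z - cinner y (z::'a::complex_inner)"
  using cinner_add_left[of x "- y" z] by simp

lemma cinner_diff_right: "cinner x (y - z) = cinner x y - cinner x (z::'a::complex_inner)"
  using cinner_add_right[of x y "- z"] by simp

text \<open>Rotating one argument by \<i> recovers the imaginary part from the real product, so
  facts proved for \<open>inner\<close> lift to \<open>cinner\<close>.\<close>

lemma inner_scaleC_ii: "inner x (\<i> *\<^sub>C y) = Im (cinner x (y::'a::complex_inner))"
  by (simp add: inner_eq_Re_cinner cinner_scaleC_right)

lemma inner_ii_scaleC: "inner (\<i> *\<^sub>C x) y = - Im (cinner x (y::'a::complex_inner))"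
  by (simp add: inner_eq_Re_cinner cinner_scaleC_left)

lemma inner_scaleC_right:
  "inner x (c *\<^sub>C y) = inner (cnj c *\<^sub>C x) (y::'a::complex_inner)"
  by (simp add: inner_eq_Re_cinner cinner_scaleC_left cinner_scaleC_right)

lemma cinner_self_real: "cinner x (x::'a::complex_inner) = complex_of_real (inner x x)"
  using cinner_commute[of x x] by (simp add: complex_eq_iff inner_eq_Re_cinner)

lemma norm_scaleC [simp]: "norm (c *\<^sub>C x) = cmod c * norm (x::'a::complex_inner)"
proof -
  have "cinner (c *\<^sub>C x) (c *\<^sub>C x) = (c * cnj c) * cinner x x"
    by (simp add: cinner_scaleC_left cinner_scaleC_right)
  then have "inner (c *\<^sub>C x) (c *\<^sub>C x) = (cmod c)\<^sup>2 * inner x x"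
    by (simp add: cinner_self_real complex_norm_square[symmetric] flip: of_real_power of_real_mult)
  then show ?thesis
    by (simp add: norm_eq_sqrt_inner real_sqrt_mult)
qed

section \<open>Bounded operators and adjoints\<close>

lemma bounded_clinear_linear: "bounded_clinear A \<Longrightarrow> linear A"
  by (simp add: bounded_clinear_def bounded_linear.linear)

lemma
  assumes "bounded_clinear A"
  shows bounded_clinear_add: "A (x + y) = A x + A y"
    and bounded_clinear_diff: "A (x - y) = A x - A y"
    and bounded_clinear_minus: "A (- x) = - A x"
    and bounded_clinear_zero: "A 0 = 0"
    and bounded_clinear_scaleC: "A (c *\<^sub>C x) = c *\<^sub>C A x"
    and bounded_clinear_scaleR: "A (r *\<^sub>R x) = r *\<^sub>R A x"
  using assms bounded_clinear_linear[OF assms]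
  by (simp_all add: linear_add linear_diff linear_neg linear_0 linear_scale bounded_clinear_def)

lemmas bounded_clinear_simps =
  bounded_clinear_add bounded_clinear_diff bounded_clinear_minus bounded_clinear_zero
  bounded_clinear_scaleC

lemma bounded_clinear_compose:
  "bounded_clinear A \<Longrightarrow> bounded_clinear B \<Longrightarrow> bounded_clinear (\<lambda>x. A (B x))"
  by (simp add: bounded_clinear_def bounded_linear_compose)

lemma bounded_clinear_ident: "bounded_clinear (\<lambda>x. x)"
  by (simp add: bounded_clinear_def)

lemma bounded_clinear_plus:
  "bounded_clinear A \<Longrightarrow> bounded_clinear B \<Longrightarrow> bounded_clinear (\<lambda>x. A x + B x)"
  by (simp add: bounded_clinear_def bounded_linear_add scaleC_add_right)

lemma bounded_clinear_minus_fun: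
  "bounded_clinear A \<Longrightarrow> bounded_clinear (\<lambda>x. - A x)"
  by (simp add: bounded_clinear_def bounded_linear_minus)

lemma bounded_clinear_sub:
  "bounded_clinear A \<Longrightarrow> bounded_clinear B \<Longrightarrow> bounded_clinear (\<lambda>x. A x - B x)"
  by (simp add: bounded_clinear_def bounded_linear_sub scaleC_diff_right)

lemma bounded_clinear_cmult:
  assumes "bounded_clinear A"
  shows "bounded_clinear (\<lambda>x. c *\<^sub>C A x)"
proof -
  have "bounded_linear (\<lambda>x::'b. c *\<^sub>C x)"
    by (rule bounded_linear_intro[where K = "cmod c"])
      (simp_all add: scaleC_add_right scaleR_scaleC scaleC_scaleC mult.commute)
  then have "bounded_linear (\<lambda>x. c *\<^sub>C A x)"
    using assms bounded_linear_compose by (fastforce simp: bounded_clinear_def)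
  then show ?thesis
    using assms by (simp add: bounded_clinear_def scaleC_scaleC mult.commute)
qed

lemmas bounded_clinear_intros =
  bounded_clinear_ident bounded_clinear_plus bounded_clinear_minus_fun
  bounded_clinear_sub bounded_clinear_cmult

section \<open>Riesz representation, adjoints and closed ranges\<close>

text \<open>A nonnegative quadratic that vanishes at 0 has its minimum there, so its derivative at 0
  is zero. This first-order condition serves the minimisation in the Riesz theorem and the vanishing
  criterion \<open>nonneg_op_zeroI\<close>.\<close>

lemma quadratic_nonneg_linear_coeff_zero:
  fixes a b :: real
  assumes "\<And>t. 0 \<le> 2 * t * a + t\<^sup>2 * b" "0 \<le> b"
  shows "a = 0"
proof -
  \<comment> \<open>With b + 1 in place of b the choice also works for b = 0; it makes the quadratic
    equal to -(t^2 (b + 2)).\<close>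
  define t where "t = - a / (b + 1)"
  have a: "a = - (t * (b + 1))"
    using assms(2) by (simp add: t_def)
  have "0 \<le> 2 * t * a + t\<^sup>2 * b"
    by (rule assms)
  also have "\<dots> = - (t\<^sup>2 * (b + 2))"
    by (simp add: a algebra_simps power2_eq_square)
  finally have "t\<^sup>2 * (b + 2) \<le> 0"
    by simp
  then have "t = 0"
    using assms(2) by (simp add: mult_le_0_iff)
  then show ?thesis
    by (simp add: a)
qed

text \<open>
  Riesz representation for a functional that factors through \<open>B\<close>; the representing vector is the
  limit of \<open>B x\<close> along a minimising sequence of \<open>\<parallel>B x\<parallel>\<^sup>2 - 2 f x\<close>. With \<open>B\<close> the identity it is the
  usual theorem, and with \<open>f x = inner (B x) y\<close> it gives the orthogonal projection of \<open>y\<close> onto the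
  closed range of \<open>B\<close>.
\<close>

lemma riesz_representation_range:
  fixes B :: "'a::real_vector \<Rightarrow> 'b::{real_inner,complete_space}" and f :: "'a \<Rightarrow> real"
  assumes B: "linear B" and f: "linear f" and bound: "\<And>x. \<bar>f x\<bar> \<le> M * norm (B x)"
  shows "\<exists>r\<in>closure (range B). \<forall>x. f x = inner (B x) r"
proof -
  define g where "g x = (norm (B x))\<^sup>2 - 2 * f x" for x
  \<comment> \<open>Completing the square: the bound on f gives g x >= (norm (B x) - M)^2 -
    M^2.\<close>
  have g_lower: "- M\<^sup>2 \<le> g x" for x
  proof -
    have "0 \<le> (norm (B x) - M)\<^sup>2" by simp
    then show ?thesis
      using bound[of x] by (simp add: g_def power2_diff abs_le_iff mult.commute)
  qed
  define m where "m = Inf (range g)"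
  have bdd: "bdd_below (range g)"
    using g_lower by (auto intro!: bdd_belowI)
  have m_le: "m \<le> g x" for x
    unfolding m_def using bdd by (simp add: cInf_lower)
  have "\<exists>x. g x < m + 1 / Suc n" for n
    using cInf_lessD[of "range g" "m + 1 / Suc n"] by (auto simp: m_def)
  then obtain u where u: "\<And>n. g (u n) < m + 1 / Suc n"
    by metis
  \<comment> \<open>Parallelogram law for B (u n) and B (u k): at the midpoint g is still at least
    m, which leaves only the excesses of the two values over m.\<close>
  have close: "(norm (B (u n) - B (u k)))\<^sup>2 \<le> 2 / Suc n + 2 / Suc k" for n k
  proof -
    have "m \<le> g ((1/2) *\<^sub>R (u n + u k))"
      by (rule m_le)
    also have "\<dots> = (1/4) * (norm (B (u n) + B (u k)))\<^sup>2 - f (u n) - f (u k)"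
      unfolding g_def linear_scale[OF B] linear_scale[OF f] linear_add[OF B] linear_add[OF f]
        norm_scaleR power_mult_distrib by (simp add: power2_eq_square add_divide_distrib)
    finally have "4 * m \<le> (norm (B (u n) + B (u k)))\<^sup>2 - 4 * f (u n) - 4 * f (u k)"
      by simp
    moreover have "(norm (B (u n) + B (u k)))\<^sup>2 + (norm (B (u n) - B (u k)))\<^sup>2
        = 2 * (norm (B (u n)))\<^sup>2 + 2 * (norm (B (u k)))\<^sup>2"
      by (simp add: power2_norm_eq_inner inner_add_left inner_add_right inner_diff_left
          inner_diff_right inner_commute)
    ultimately show ?thesis
      using u[of n] u[of k] by (simp add: g_def)
  qed
  have "Cauchy (\<lambda>n. B (u n))"
  proof (rule metric_CauchyI)
    fix e :: real assume "0 < e"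
    then obtain N where N: "4 / e\<^sup>2 < real N"
      using reals_Archimedean2 by blast
    show "\<exists>N. \<forall>m\<ge>N. \<forall>n\<ge>N. dist (B (u m)) (B (u n)) < e"
    proof (intro exI allI impI)
      fix m n assume "N \<le> m" "N \<le> n"
      then have "2 / Suc m \<le> 2 / Suc N" "2 / Suc n \<le> 2 / Suc N"
        by (simp_all add: frac_le)
      then have "(norm (B (u m) - B (u n)))\<^sup>2 \<le> 4 / Suc N"
        using close[of m n] by simp
      also have "\<dots> < e\<^sup>2"
        using N \<open>0 < e\<close> by (simp add: field_simps) (smt (verit) zero_less_power)
      finally show "dist (B (u m)) (B (u n)) < e"
        using \<open>0 < e\<close> by (simp add: dist_norm power_less_imp_less_base)
    qed
  qed
  then obtain r where r: "(\<lambda>n. B (u n)) \<longlonglongrightarrow> r"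
    using Cauchy_convergent_iff convergent_def by blast
  have "f x = inner (B x) r" for x
  proof -
    \<comment> \<open>Variation of the minimiser: g at u n + t x cannot drop below m, while g (u n)
      exceeds m by less than 1/(n+1). The limit over n leaves a quadratic in t.\<close>
    have "0 \<le> 2 * t * (inner r (B x) - f x) + t\<^sup>2 * (norm (B x))\<^sup>2" for t
    proof (rule LIMSEQ_le)
      show "(\<lambda>n. - (1 / real (Suc n))) \<longlonglongrightarrow> 0"
        using tendsto_minus[OF LIMSEQ_inverse_real_of_nat] by (simp add: inverse_eq_divide)
      show "(\<lambda>n. 2 * t * (inner (B (u n)) (B x) - f x) + t\<^sup>2 * (norm (B x))\<^sup>2) \<longlonglongrightarrow>
          2 * t * (inner r (B x) - f x) + t\<^sup>2 * (norm (B x))\<^sup>2"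
        by (intro tendsto_intros r)
      have "- (1 / real (Suc n)) \<le> 2 * t * (inner (B (u n)) (B x) - f x) + t\<^sup>2 * (norm (B x))\<^sup>2" for n
      proof -
        have "m \<le> g (u n + t *\<^sub>R x)"
          by (rule m_le)
        also have "\<dots> = g (u n) + (2 * t * (inner (B (u n)) (B x) - f x) + t\<^sup>2 * (norm (B x))\<^sup>2)"
          by (simp add: g_def linear_scale[OF B] linear_scale[OF f] linear_add[OF B] linear_add[OF f]
              power2_norm_eq_inner inner_add_left inner_add_right inner_commute)
            (simp add: power2_eq_square algebra_simps)
        finally show ?thesis
          using u[of n] by simp
      qed
      then show "\<exists>N. \<forall>n\<ge>N. - (1 / real (Suc n))
          \<le> 2 * t * (inner (B (u n)) (B x) - f x) + t\<^sup>2 * (norm (B x))\<^sup>2"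
        by blast
    qed
    then have "inner r (B x) - f x = 0"
      by (rule quadratic_nonneg_linear_coeff_zero) simp
    then show ?thesis
      by (simp add: inner_commute)
  qed
  moreover have "r \<in> closure (range B)"
    unfolding closure_sequential by (intro exI[of _ "\<lambda>n. B (u n)"] conjI allI r rangeI)
  ultimately show ?thesis
    by blast
qed

text \<open>The real identity at \<open>\<i> *\<^sub>C x\<close> gives the imaginary parts, as A
  commutes with multiplication by \<i>.\<close>

lemma cinner_eq_if_inner_eq:
  assumes A: "\<And>c x. A (c *\<^sub>C x) = c *\<^sub>C A (x::'a::complex_inner)"
    and AB: "\<And>x y. inner (A x) y = inner x (B (y::'b::complex_inner))"
  shows "cinner (A x) y = cinner x (B y)"
proof -
  have "inner (A (\<i> *\<^sub>C x)) y = inner (\<i> *\<^sub>C x) (B y)"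
    by (rule AB)
  then have "Im (cinner (A x) y) = Im (cinner x (B y))"
    by (simp add: A inner_ii_scaleC)
  then show ?thesis
    using AB[of x y] by (simp add: complex_eq_iff inner_eq_Re_cinner)
qed

lemma cadjoint_eqI:
  assumes "\<And>x y. cinner (A x) y = cinner x (B y)"
  shows "cadjoint A = B"
  unfolding cadjoint_def
proof (rule the_equality)
  fix B' assume *: "\<forall>x y. cinner (A x) y = cinner x (B' y)"
  show "B' = B"
  proof
    fix y
    have "cinner (B' y - B y) (B' y - B y) = 0"
      using *[rule_format, of "B' y - B y" y] assms[of "B' y - B y" y]
      by (simp add: cinner_diff_right)
    then show "B' y = B y"
      by (simp add: cinner_self_real)
  qed
qed (simp add: assms)

text \<open>Riesz representation of each functional x |-> inner (A x) y gives the real adjoint B,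
  and complex homogeneity of A turns it into the complex one. The bound on A carries over to B
  through norm (B y)^2 = inner (A (B y)) y.\<close>

lemma
  assumes A: "bounded_clinear A"
  shows cinner_cadjoint_right: "cinner (A x) y = cinner x (cadjoint A y)"
    and bounded_clinear_cadjoint: "bounded_clinear (cadjoint A)"
proof -
  interpret A: bounded_linear A
    using A by (simp add: bounded_clinear_def)
  have "\<exists>r. \<forall>x. inner (A x) y = inner x r" for y
  proof -
    obtain M where M: "\<And>x. norm (A x) \<le> norm x * M"
      using A.bounded by blast
    have "\<bar>inner (A x) y\<bar> \<le> (M * norm y) * norm x" for x
    proof -
      have "\<bar>inner (A x) y\<bar> \<le> norm (A x) * norm y"
        by (rule Cauchy_Schwarz_ineq2)
      also have "\<dots> \<le> (norm x * M) * norm y"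
        by (intro mult_right_mono M) simp
      finally show ?thesis
        by (simp add: mult_ac)
    qed
    moreover have "linear (\<lambda>x. inner (A x) y)"
      by (rule linearI) (simp_all add: A.add A.scaleR inner_add_left)
    ultimately show ?thesis
      using riesz_representation_range[of "\<lambda>x. x" "\<lambda>x. inner (A x) y" "M * norm y"]
        linear_id by (auto simp: id_def)
  qed
  then obtain B where B: "\<And>x y. inner (A x) y = inner x (B y)"
    by metis
  have cB: "cinner (A x) y = cinner x (B y)" for x y
    by (rule cinner_eq_if_inner_eq[OF bounded_clinear_scaleC[OF A] B])
  then have adj: "cadjoint A = B"
    by (rule cadjoint_eqI)
  show "cinner (A x) y = cinner x (cadjoint A y)"
    by (simp add: adj cB)
  have ext: "y = z" if "\<And>x. cinner x y = cinner x z" for y z :: 'a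
    using that[of "y - z"] cinner_self_real[of "y - z"] by (simp add: cinner_diff_right)
  have B_scaleC: "B (c *\<^sub>C y) = c *\<^sub>C B y" for c y
    by (rule ext) (simp add: cB[symmetric] cinner_scaleC_right)
  have "bounded_linear B"
  proof -
    obtain M where M: "M \<ge> 0" "\<And>x. norm (A x) \<le> norm x * M"
      using A.nonneg_bounded by blast
    show ?thesis
    proof (rule bounded_linear_intro[where K = M])
      show "B (x + y) = B x + B y" for x y
        by (rule ext) (simp add: cB[symmetric] cinner_add_right)
      show "B (r *\<^sub>R x) = r *\<^sub>R B x" for r x
        by (simp add: scaleR_scaleC B_scaleC)
      show "norm (B y) \<le> norm y * M" for y
      proof -
        have "norm (B y) * norm (B y) = inner (A (B y)) y"
          by (simp add: B flip: power2_eq_square power2_norm_eq_inner)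
        also have "\<dots> \<le> norm (A (B y)) * norm y"
          by (rule norm_cauchy_schwarz)
        also have "\<dots> \<le> norm (B y) * M * norm y"
          by (intro mult_right_mono M) simp
        finally show ?thesis
          using M(1) by (cases "norm (B y) = 0") (simp_all add: mult_ac)
      qed
    qed
  qed
  with B_scaleC show "bounded_clinear (cadjoint A)"
    by (simp add: adj bounded_clinear_def)
qed

lemma cinner_cadjoint_left:
  "bounded_clinear A \<Longrightarrow> cinner (cadjoint A y) x = cinner y (A x)"
  by (metis cinner_cadjoint_right cinner_commute)

lemma inner_cadjoint_right:
  "bounded_clinear A \<Longrightarrow> inner (A x) y = inner x (cadjoint A y)"
  by (simp add: inner_eq_Re_cinner cinner_cadjoint_right)

lemma inner_cadjoint_left:
  "bounded_clinear A \<Longrightarrow> inner (cadjoint A y) x = inner y (A x)"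
  by (simp add: inner_eq_Re_cinner cinner_cadjoint_left)

lemma cadjoint_cadjoint: "bounded_clinear A \<Longrightarrow> cadjoint (cadjoint A) = A"
  by (rule cadjoint_eqI) (simp add: cinner_cadjoint_left)

lemma contraction_iff:
  "contraction A \<longleftrightarrow> bounded_clinear A \<and> (\<forall>x. norm (A x) \<le> norm x)"
proof
  assume "contraction A"
  then have A: "bounded_clinear A" "onorm A \<le> 1"
    by (simp_all add: contraction_def)
  have "norm (A x) \<le> norm x" for x
  proof -
    have "norm (A x) \<le> onorm A * norm x"
      using A(1) onorm by (auto simp: bounded_clinear_def)
    also have "\<dots> \<le> 1 * norm x"
      by (intro mult_right_mono A) simp
    finally show ?thesis by simp
  qed
  with A show "bounded_clinear A \<and> (\<forall>x. norm (A x) \<le> norm x)"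
    by blast
qed (auto simp: contraction_def intro!: onorm_bound)

lemma contraction_cadjoint:
  assumes "contraction A"
  shows "contraction (cadjoint A)"
proof -
  have A: "bounded_clinear A" and le: "\<And>x. norm (A x) \<le> norm x"
    using assms by (auto simp: contraction_iff)
  have "norm (cadjoint A y) \<le> norm y" for y
  proof -
    have "norm (cadjoint A y) * norm (cadjoint A y) = inner (A (cadjoint A y)) y"
      by (simp add: inner_cadjoint_right[OF A] flip: power2_eq_square power2_norm_eq_inner)
    also have "\<dots> \<le> norm (A (cadjoint A y)) * norm y"
      by (rule norm_cauchy_schwarz)
    also have "\<dots> \<le> norm (cadjoint A y) * norm y"
      by (intro mult_right_mono le) simp
    finally show ?thesis
      by (cases "norm (cadjoint A y) = 0") simp_all
  qed
  then show ?thesis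
    by (simp add: contraction_iff bounded_clinear_cadjoint A)
qed

text \<open>The projection r of y onto the closed range, taken from the Riesz lemma, leaves y - r in
  the kernel of the adjoint. By hypothesis y - r is then orthogonal to y, and it is orthogonal to r
  as well, hence zero. Later arguments about closed ranges mostly go through this orthogonality
  test.\<close>

lemma in_closure_range_iff:
  assumes C: "bounded_clinear C"
  shows "y \<in> closure (range C) \<longleftrightarrow> (\<forall>w. cadjoint C w = 0 \<longrightarrow> inner w y = 0)"
proof
  have orth: "inner w y = 0" if w: "\<forall>x. inner w (C x) = 0" and y: "y \<in> closure (range C)" for w y
  proof -
    obtain u where u: "\<And>n. u n \<in> range C" "u \<longlonglongrightarrow> y"
      using y by (auto simp: closure_sequential)
    have "(\<lambda>n. inner w (u n)) \<longlonglongrightarrow> inner w y"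
      by (intro tendsto_intros u)
    moreover have "inner w (u n) = 0" for n
      using u(1)[of n] w by auto
    ultimately show ?thesis
      by (simp add: LIMSEQ_const_iff)
  qed
  show "\<forall>w. cadjoint C w = 0 \<longrightarrow> inner w y = 0" if "y \<in> closure (range C)"
    using orth[OF _ that] by (metis inner_cadjoint_left[OF C] inner_zero_left)
  assume *: "\<forall>w. cadjoint C w = 0 \<longrightarrow> inner w y = 0"
  have "\<exists>r\<in>closure (range C). \<forall>x. inner (C x) y = inner (C x) r"
  proof (rule riesz_representation_range[where M = "norm y"])
    show "linear C"
      by (rule bounded_clinear_linear[OF C])
    show "linear (\<lambda>x. inner (C x) y)"
      by (rule linearI) (simp_all add: bounded_clinear_add[OF C] bounded_clinear_scaleR[OF C] inner_add_left)
    show "\<bar>inner (C x) y\<bar> \<le> norm y * norm (C x)" for x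
      using Cauchy_Schwarz_ineq2[of "C x" y] by (simp add: mult.commute)
  qed
  then obtain r where r: "r \<in> closure (range C)" "\<And>x. inner (C x) y = inner (C x) r"
    by blast
  have *: "inner (y - r) (C x) = 0" for x
    using r(2)[of x] by (simp add: inner_diff_right inner_commute[of _ "C x"])
  then have "inner (cadjoint C (y - r)) (cadjoint C (y - r)) = 0"
    by (simp add: inner_cadjoint_left[OF C])
  then have "inner (y - r) y = 0"
    using \<open>\<forall>w. cadjoint C w = 0 \<longrightarrow> inner w y = 0\<close> by simp
  moreover have "inner (y - r) r = 0"
    using orth[OF _ r(1)] * by blast
  ultimately have "inner (y - r) (y - r) = 0"
    by (simp add: inner_diff_right)
  with r(1) show "y \<in> closure (range C)"
    by simp
qed

section \<open>Square roots of nonnegative operators\<close>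

lemma nonneg_opD:
  assumes "nonneg_op A"
  shows "bounded_clinear A" "0 \<le> inner (A x) x" "cinner (A x) x \<in> \<real>"
  using assms by (simp_all add: nonneg_op_def inner_eq_Re_cinner)

text \<open>Polarisation: reality of the quadratic form at x + y and at x + \<i> y yields the
  imaginary and the real part of the symmetry.\<close>

lemma nonneg_op_selfadjoint:
  assumes A: "nonneg_op A"
  shows "cadjoint A = A"
proof (rule cadjoint_eqI)
  note lin = bounded_clinear_simps[OF nonneg_opD(1)[OF A]]
  have im: "Im (cinner (A x) x) = 0" for x
    using nonneg_opD(3)[OF A] complex_is_Real_iff by blast
  show "cinner (A x) y = cinner x (A y)" for x y
  proof -
    have "Im (cinner (A x) y) = - Im (cinner (A y) x)"
      using im[of "x + y"] im[of x] im[of y]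
      by (simp add: lin cinner_add_left cinner_add_right)
    moreover have "Re (cinner (A x) y) = Re (cinner (A y) x)"
      using im[of "x + \<i> *\<^sub>C y"] im[of x] im[of y]
      by (simp add: lin cinner_add_left cinner_add_right cinner_scaleC_left cinner_scaleC_right)
    ultimately show ?thesis
      by (simp add: complex_eq_iff cinner_commute[of x])
  qed
qed

lemma nonneg_op_inner_commute:
  "nonneg_op A \<Longrightarrow> inner (A x) y = inner x (A y)"
  by (metis inner_cadjoint_right nonneg_opD(1) nonneg_op_selfadjoint)

text \<open>The form at y + t A y is nonnegative for all t, and its linear coefficient in t is twice
  norm (A y)^2.\<close>

lemma nonneg_op_zeroI:
  assumes A: "nonneg_op A" and y: "inner (A y) y = 0"
  shows "A y = 0"
proof -
  note lin = bounded_clinear_simps[OF nonneg_opD(1)[OF A]] bounded_clinear_scaleR[OF nonneg_opD(1)[OF A]]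
  have "0 \<le> 2 * t * inner (A y) (A y) + t\<^sup>2 * inner (A (A y)) (A y)" for t
    using nonneg_opD(2)[OF A, of "y + t *\<^sub>R A y"] y
    by (simp add: lin inner_add_left inner_add_right power2_eq_square algebra_simps
        nonneg_op_inner_commute[OF A, of "A y" y])
  then have "inner (A y) (A y) = 0"
    using quadratic_nonneg_linear_coeff_zero nonneg_opD(2)[OF A] by blast
  then show ?thesis
    by simp
qed

section \<open>The square root as limit of an operator iteration\<close>

text \<open>Fixed-point iteration for Y = (X + Y^2) / 2. This equation says (I - Y)^2 = I - X, so
  the limit Y yields the root I - Y.\<close>

primrec sqrt_approx :: "('a::complex_hilbert \<Rightarrow>\<^sub>L 'a) \<Rightarrow> nat \<Rightarrow> 'a \<Rightarrow>\<^sub>L 'a" where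
  "sqrt_approx X 0 = 0"
| "sqrt_approx X (Suc n) = (1/2) *\<^sub>R (X + (sqrt_approx X n o\<^sub>L sqrt_approx X n))"

primrec sqrt_approx_bound :: "nat \<Rightarrow> real" where
  "sqrt_approx_bound 0 = 0"
| "sqrt_approx_bound (Suc n) = (1 + (sqrt_approx_bound n)\<^sup>2) / 2"

lemma sqrt_approx_bound: "0 \<le> sqrt_approx_bound n" "sqrt_approx_bound n \<le> 1"
proof (induction n)
  case (Suc n)
  { case 1 show ?case by simp }
  { case 2 show ?case using Suc by (simp add: power_le_one) }
qed simp_all

text \<open>
  The iterates are polynomials in \<open>X\<close> with nonnegative coefficients, as are their successive
  differences; hence both are dominated in norm by the scalar iteration for \<open>X = 1\<close>.
\<close>

lemma norm_sqrt_approx_le: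
  assumes "norm X \<le> 1"
  shows "norm (sqrt_approx X n) \<le> sqrt_approx_bound n"
proof (induction n)
  case (Suc n)
  have "norm (sqrt_approx X n o\<^sub>L sqrt_approx X n) \<le> norm (sqrt_approx X n) * norm (sqrt_approx X n)"
    by (rule norm_blinfun_compose)
  also have "\<dots> \<le> sqrt_approx_bound n * sqrt_approx_bound n"
    by (intro mult_mono Suc sqrt_approx_bound) simp
  finally have "norm (X + (sqrt_approx X n o\<^sub>L sqrt_approx X n)) \<le> 1 + (sqrt_approx_bound n)\<^sup>2"
    using assms norm_triangle_ineq[of X "sqrt_approx X n o\<^sub>L sqrt_approx X n"]
    by (simp add: power2_eq_square)
  then show ?case
    by simp
qed simp

lemma norm_sqrt_approx_diff_le:
  assumes "norm X \<le> 1"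
  shows "norm (sqrt_approx X (Suc n) - sqrt_approx X n) \<le> sqrt_approx_bound (Suc n) - sqrt_approx_bound n"
proof (induction n)
  case 0
  with assms show ?case by simp
next
  case (Suc n)
  define P where "P = sqrt_approx X (Suc n)"
  define P' where "P' = sqrt_approx X n"
  define p where "p = sqrt_approx_bound (Suc n)"
  define p' where "p' = sqrt_approx_bound n"
  have d: "norm (P - P') \<le> p - p'"
    using Suc by (simp only: P_def P'_def p_def p'_def)
  have P: "norm P \<le> p" "norm P' \<le> p'"
    using norm_sqrt_approx_le[OF assms] by (simp_all only: P_def P'_def p_def p'_def)
  \<comment> \<open>The difference of squares is split in an order valid for noncommuting operators;
    the scalar bounds recombine to p^2 - p'^2.\<close>
  have "(P o\<^sub>L P) - (P' o\<^sub>L P') = (P o\<^sub>L (P - P')) + ((P - P') o\<^sub>L P')"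
    by (rule blinfun_eqI) (simp add: blinfun.diff_left blinfun.add_left blinfun.diff_right)
  then have "norm ((P o\<^sub>L P) - (P' o\<^sub>L P')) \<le> norm (P o\<^sub>L (P - P')) + norm ((P - P') o\<^sub>L P')"
    using norm_triangle_ineq by metis
  also have "\<dots> \<le> norm P * norm (P - P') + norm (P - P') * norm P'"
    by (intro add_mono norm_blinfun_compose)
  also have "\<dots> \<le> p * (p - p') + (p - p') * p'"
    by (intro add_mono mult_mono P d) (use P d norm_ge_zero order_trans in blast)+
  finally have "norm ((P o\<^sub>L P) - (P' o\<^sub>L P')) \<le> p\<^sup>2 - p'\<^sup>2"
    by (simp add: power2_eq_square algebra_simps)
  moreover have "sqrt_approx X (Suc (Suc n)) - sqrt_approx X (Suc n) = (1/2) *\<^sub>R ((P o\<^sub>L P) - (P' o\<^sub>L P'))"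
    unfolding P_def P'_def sqrt_approx.simps(2)[of X "Suc n"] by (simp add: algebra_simps)
  moreover have "sqrt_approx_bound (Suc (Suc n)) - sqrt_approx_bound (Suc n) = (p\<^sup>2 - p'\<^sup>2) / 2"
    by (simp only: sqrt_approx_bound.simps(2) flip: diff_divide_distrib) (simp add: p_def p'_def)
  ultimately show ?case
    by (simp only: norm_scaleR) simp
qed

text \<open>The increments are dominated by those of a scalar sequence that increases and stays
  below 1, and these telescope to a summable series. Hence the iteration converges in operator norm
  and the recursion passes to the limit.\<close>

lemma sqrt_approx_convergent:
  assumes "norm X \<le> 1"
  obtains Y where "sqrt_approx X \<longlonglongrightarrow> Y" "norm Y \<le> 1" "2 *\<^sub>R Y = X + (Y o\<^sub>L Y)"
proof -
  \<comment> \<open>The scalar sequence increases because each of its increments bounds a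
    norm.\<close>
  have inc: "incseq sqrt_approx_bound"
  proof (rule incseq_SucI)
    fix n
    have "0 \<le> sqrt_approx_bound (Suc n) - sqrt_approx_bound n"
      using norm_sqrt_approx_diff_le[OF assms, of n] norm_ge_zero order_trans by blast
    then show "sqrt_approx_bound n \<le> sqrt_approx_bound (Suc n)"
      by (simp only: diff_ge_0_iff_ge)
  qed
  then obtain l where "sqrt_approx_bound \<longlonglongrightarrow> l"
    using incseq_convergent[OF inc, of 1] sqrt_approx_bound(2) by blast
  then have "summable (\<lambda>n. sqrt_approx_bound (Suc n) - sqrt_approx_bound n)"
    by (rule telescope_summable)
  then have "summable (\<lambda>n. sqrt_approx X (Suc n) - sqrt_approx X n)"
    using norm_sqrt_approx_diff_le[OF assms] by (rule summable_comparison_test'[where N = 0])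
  then have "convergent (\<lambda>n. \<Sum>k<n. sqrt_approx X (Suc k) - sqrt_approx X k)"
    by (simp only: summable_iff_convergent)
  then obtain Y where Y: "sqrt_approx X \<longlonglongrightarrow> Y"
    by (simp only: sum_lessThan_telescope) (auto simp: convergent_def)
  have "norm (sqrt_approx X n) \<le> 1" for n
    using norm_sqrt_approx_le[OF assms, of n] sqrt_approx_bound(2)[of n] by linarith
  then have "norm Y \<le> 1"
    using Lim_bounded[OF tendsto_norm[OF Y]] by blast
  moreover have "2 *\<^sub>R Y = X + (Y o\<^sub>L Y)"
  proof (rule LIMSEQ_unique)
    show "(\<lambda>n. 2 *\<^sub>R sqrt_approx X (Suc n)) \<longlonglongrightarrow> 2 *\<^sub>R Y"
      by (intro tendsto_intros LIMSEQ_Suc Y)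
    have "(\<lambda>n. X + (sqrt_approx X n o\<^sub>L sqrt_approx X n)) \<longlonglongrightarrow> X + (Y o\<^sub>L Y)"
      by (intro tendsto_intros bounded_bilinear.tendsto[OF bounded_bilinear_blinfun_compose] Y)
    then show "(\<lambda>n. 2 *\<^sub>R sqrt_approx X (Suc n)) \<longlonglongrightarrow> X + (Y o\<^sub>L Y)"
      by simp
  qed
  ultimately show ?thesis
    using that Y by blast
qed

text \<open>Intertwining passes to the polynomials \<open>sqrt_approx X n\<close> and afterwards to
  their limit. C is only real linear, so that multiplication by a complex scalar is an admissible
  choice.\<close>

lemma sqrt_approx_intertwine:
  assumes C: "bounded_linear C" and CX: "\<And>x. C (blinfun_apply X x) = blinfun_apply X' (C x)"
  shows "C (blinfun_apply (sqrt_approx X n) x) = blinfun_apply (sqrt_approx X' n) (C x)"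
proof -
  interpret bounded_linear C by fact
  show ?thesis
    by (induction n arbitrary: x)
      (simp_all add: zero CX add scaleR blinfun.add_left blinfun.scaleR_left)
qed

lemma sqrt_limit_intertwine:
  assumes C: "bounded_linear C" and CX: "\<And>x. C (blinfun_apply X x) = blinfun_apply X' (C x)"
    and Y: "sqrt_approx X \<longlonglongrightarrow> Y" and Y': "sqrt_approx X' \<longlonglongrightarrow> Y'"
  shows "C (blinfun_apply Y x) = blinfun_apply Y' (C x)"
proof (rule LIMSEQ_unique)
  show "(\<lambda>n. C (blinfun_apply (sqrt_approx X n) x)) \<longlonglongrightarrow> C (blinfun_apply Y x)"
    by (intro bounded_linear.tendsto[OF C] tendsto_intros Y)
  show "(\<lambda>n. C (blinfun_apply (sqrt_approx X n) x)) \<longlonglongrightarrow> blinfun_apply Y' (C x)"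
    unfolding sqrt_approx_intertwine[OF C CX] by (intro tendsto_intros Y')
qed

text \<open>For y = B x - B' x, commutation gives B y + B' y = B^2 x - B'^2 x = 0. Both forms are
  nonnegative, so B y = B' y = 0, and norm y^2 = inner x (B y - B' y) vanishes.\<close>

lemma nonneg_sqrt_unique:
  assumes B: "nonneg_op B" "\<And>x. B (B x) = A x" and B': "nonneg_op B'" "\<And>x. B' (B' x) = A x"
    and comm: "\<And>x. B (B' x) = B' (B x)"
  shows "B = B'"
proof
  fix x
  note lin = bounded_clinear_simps[OF nonneg_opD(1)[OF B(1)]] bounded_clinear_simps[OF nonneg_opD(1)[OF B'(1)]]
  define y where "y = B x - B' x"
  have "B y + B' y = 0"
    by (simp add: y_def lin B B' comm)
  then have "inner (B y) y + inner (B' y) y = 0"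
    by (simp flip: inner_add_left)
  then have "inner (B y) y = 0" "inner (B' y) y = 0"
    using nonneg_opD(2)[OF B(1), of y] nonneg_opD(2)[OF B'(1), of y] by linarith+
  then have "B y = 0" "B' y = 0"
    using nonneg_op_zeroI B(1) B'(1) by blast+
  moreover have "inner y y = inner x (B y) - inner x (B' y)"
    by (simp add: nonneg_op_inner_commute[OF B(1), symmetric]
        nonneg_op_inner_commute[OF B'(1), symmetric] flip: inner_diff_left y_def)
  ultimately have "inner y y = 0"
    by simp
  then show "B x = B' x"
    by (simp add: y_def)
qed

text \<open>The root of I - X is I - Y with Y the limit of the iteration; it is nonnegative as norm
  Y <= 1. The third claim keeps Y available for intertwining arguments.\<close>

lemma op_sqrt_properties:
  fixes X :: "'a::complex_hilbert \<Rightarrow> 'a"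
  assumes X: "contraction X"
    and sa: "cadjoint X = X"
  shows nonneg_op_sqrt: "nonneg_op (op_sqrt (\<lambda>x. x - X x))"
    and op_sqrt_square: "op_sqrt (\<lambda>x. x - X x) (op_sqrt (\<lambda>x. x - X x) x) = x - X x"
    and op_sqrt_limit: "\<exists>Y. sqrt_approx (Blinfun X) \<longlonglongrightarrow> Y \<and> op_sqrt (\<lambda>x. x - X x) = (\<lambda>x. x - blinfun_apply Y x)"
proof -
  have cX: "bounded_clinear X" and le: "\<And>x. norm (X x) \<le> norm x"
    using X by (auto simp: contraction_iff)
  have blX: "bounded_linear X"
    using cX by (simp add: bounded_clinear_def)
  define XX where "XX = Blinfun X"
  have XX: "blinfun_apply XX = X"
    by (simp add: XX_def bounded_linear_Blinfun_apply blX)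
  have "norm XX \<le> 1"
    using le by (intro norm_blinfun_bound) (simp_all add: XX)
  then obtain Y where Y: "sqrt_approx XX \<longlonglongrightarrow> Y" "norm Y \<le> 1" "2 *\<^sub>R Y = XX + (Y o\<^sub>L Y)"
    by (rule sqrt_approx_convergent)
  define B where "B x = x - blinfun_apply Y x" for x
  have blB: "bounded_linear B"
    unfolding B_def by (intro bounded_linear_sub bounded_linear_ident blinfun.bounded_linear_right)
  have square: "B (B x) = x - X x" for x
  proof -
    have "2 *\<^sub>R blinfun_apply Y x = X x + blinfun_apply Y (blinfun_apply Y x)"
      using arg_cong[OF Y(3), of "\<lambda>Z. blinfun_apply Z x"]
      by (simp add: blinfun.add_left blinfun.scaleR_left XX)
    then show ?thesis
      by (simp add: B_def blinfun.diff_right scaleR_2 algebra_simps)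
  qed
  \<comment> \<open>Multiplication by c commutes with X, hence with Y. This is the complex linearity
    of the limit, which lives in a space of real linear operators.\<close>
  have "bounded_linear (\<lambda>x::'a. c *\<^sub>C x)" for c
    using bounded_clinear_cmult[OF bounded_clinear_ident] unfolding bounded_clinear_def by blast
  then have Y_scaleC: "c *\<^sub>C blinfun_apply Y x = blinfun_apply Y (c *\<^sub>C x)" for c x
    by (rule sqrt_limit_intertwine[OF _ _ Y(1) Y(1)])
      (simp add: XX bounded_clinear_scaleC[OF cX])
  have cB: "bounded_clinear B"
    using blB by (simp add: bounded_clinear_def) (simp add: B_def scaleC_diff_right Y_scaleC)
  have "inner (blinfun_apply (sqrt_approx XX n) x) y = inner x (blinfun_apply (sqrt_approx XX n) y)" for n x y
    by (induction n arbitrary: x y)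
      (simp_all add: XX blinfun.add_left blinfun.scaleR_left inner_add_left inner_add_right
        inner_cadjoint_right[OF cX] sa)
  moreover have "(\<lambda>n. inner (blinfun_apply (sqrt_approx XX n) x) y) \<longlonglongrightarrow> inner (blinfun_apply Y x) y"
    and "(\<lambda>n. inner x (blinfun_apply (sqrt_approx XX n) y)) \<longlonglongrightarrow> inner x (blinfun_apply Y y)" for x y
    by (intro tendsto_intros Y)+
  ultimately have Y_sa: "inner (blinfun_apply Y x) y = inner x (blinfun_apply Y y)" for x y
    using LIMSEQ_unique by fastforce
  have B_sa: "cinner (B x) y = cinner x (B y)" for x y
    by (rule cinner_eq_if_inner_eq[OF bounded_clinear_scaleC[OF cB]])
      (simp add: B_def inner_diff_left inner_diff_right Y_sa)
  have B_pos: "0 \<le> inner (B x) x" for x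
  proof -
    have "inner (blinfun_apply Y x) x \<le> norm (blinfun_apply Y x) * norm x"
      by (rule norm_cauchy_schwarz)
    also have "\<dots> \<le> (norm Y * norm x) * norm x"
      by (intro mult_right_mono norm_blinfun) simp
    also have "\<dots> \<le> (1 * norm x) * norm x"
      by (intro mult_right_mono Y) simp_all
    finally show ?thesis
      by (simp add: B_def inner_diff_left power2_norm_eq_inner[symmetric] power2_eq_square)
  qed
  have "cinner (B x) x \<in> \<real>" for x
    using B_sa[of x x] by (simp add: cinner_commute[of x "B x"] complex_is_Real_iff complex_eq_iff)
  with cB B_pos have B: "nonneg_op B"
    by (simp add: nonneg_op_def inner_eq_Re_cinner)
  have sqrt: "op_sqrt (\<lambda>x. x - X x) = B"
    unfolding op_sqrt_def
  proof (rule the_equality)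
    \<comment> \<open>Any other root B' commutes with its own square I - X, hence with X, with the
      limit Y and with B; uniqueness for commuting roots applies.\<close>
    fix B' assume *: "nonneg_op B' \<and> (\<forall>x. B' (B' x) = x - X x)"
    note lin' = bounded_clinear_simps[OF nonneg_opD(1)[OF conjunct1[OF *]]]
    have "B' (X x) = X (B' x)" for x
    proof -
      have "B' (x - X x) = B' x - X (B' x)"
        using conjunct2[OF *, rule_format, of x] conjunct2[OF *, rule_format, of "B' x"] by simp
      then show ?thesis
        by (simp add: lin')
    qed
    then have "B' (blinfun_apply Y x) = blinfun_apply Y (B' x)" for x
      using nonneg_opD(1)[OF conjunct1[OF *]]
      by (intro sqrt_limit_intertwine[OF _ _ Y(1) Y(1)]) (simp_all add: XX bounded_clinear_def)
    then have "B (B' x) = B' (B x)" for x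
      by (simp add: B_def lin')
    then show "B' = B"
      using nonneg_sqrt_unique[of B "\<lambda>x. x - X x" B'] B square * by auto
  qed (simp add: B square)
  show "nonneg_op (op_sqrt (\<lambda>x. x - X x))"
    and "op_sqrt (\<lambda>x. x - X x) (op_sqrt (\<lambda>x. x - X x) x) = x - X x"
    by (simp_all add: sqrt B square)
  show "\<exists>Y. sqrt_approx (Blinfun X) \<longlonglongrightarrow> Y \<and> op_sqrt (\<lambda>x. x - X x) = (\<lambda>x. x - blinfun_apply Y x)"
    using Y(1) by (intro exI[of _ Y]) (simp add: sqrt B_def[abs_def] XX_def)
qed

lemma op_sqrt_intertwine:
  assumes X: "contraction X" "cadjoint X = X" and X': "contraction X'" "cadjoint X' = X'"
    and C: "bounded_clinear C" and CX: "\<And>x. C (X x) = X' (C x)"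
  shows "C (op_sqrt (\<lambda>x. x - X x) x) = op_sqrt (\<lambda>x. x - X' x) (C x)"
proof -
  obtain Y where Y: "sqrt_approx (Blinfun X) \<longlonglongrightarrow> Y" "op_sqrt (\<lambda>x. x - X x) = (\<lambda>x. x - blinfun_apply Y x)"
    using op_sqrt_limit[OF X] by blast
  obtain Y' where Y': "sqrt_approx (Blinfun X') \<longlonglongrightarrow> Y'" "op_sqrt (\<lambda>x. x - X' x) = (\<lambda>x. x - blinfun_apply Y' x)"
    using op_sqrt_limit[OF X'] by blast
  have "blinfun_apply (Blinfun X) = X" "blinfun_apply (Blinfun X') = X'"
    using X(1) X'(1) by (simp_all add: contraction_def bounded_clinear_def bounded_linear_Blinfun_apply)
  then have "C (blinfun_apply Y x) = blinfun_apply Y' (C x)"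
    using C CX by (intro sqrt_limit_intertwine[OF _ _ Y(1) Y'(1)]) (simp_all add: bounded_clinear_def)
  then show ?thesis
    by (simp add: Y Y' bounded_clinear_diff[OF C])
qed

section \<open>Defect operators\<close>

lemma contraction_gram:
  assumes "contraction A"
  shows "contraction (\<lambda>x. cadjoint A (A x))" "cadjoint (\<lambda>x. cadjoint A (A x)) = (\<lambda>x. cadjoint A (A x))"
proof -
  have A: "bounded_clinear A" and le: "\<And>x. norm (A x) \<le> norm x"
    using assms by (auto simp: contraction_iff)
  have le': "\<And>x. norm (cadjoint A x) \<le> norm x"
    using contraction_cadjoint[OF assms] by (auto simp: contraction_iff)
  show "contraction (\<lambda>x. cadjoint A (A x))"
    using bounded_clinear_compose[OF bounded_clinear_cadjoint[OF A] A] order_trans[OF le' le]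
    by (simp add: contraction_iff)
  show "cadjoint (\<lambda>x. cadjoint A (A x)) = (\<lambda>x. cadjoint A (A x))"
    by (rule cadjoint_eqI) (simp add: cinner_cadjoint_left[OF A] cinner_cadjoint_right[OF A])
qed

lemma
  assumes "contraction A"
  shows nonneg_defect_op: "nonneg_op (defect_op A)"
    and defect_op_square: "defect_op A (defect_op A x) = x - cadjoint A (A x)"
  using op_sqrt_properties[OF contraction_gram[OF assms]] by (simp_all add: defect_op_def)

lemma contraction_defect_op:
  assumes "contraction A"
  shows "contraction (defect_op A)"
proof -
  have A: "bounded_clinear A"
    using assms by (simp add: contraction_def)
  have "(norm (defect_op A x))\<^sup>2 = inner x (defect_op A (defect_op A x))" for x
    by (simp add: power2_norm_eq_inner nonneg_op_inner_commute[OF nonneg_defect_op[OF assms]])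
  then have "(norm (defect_op A x))\<^sup>2 \<le> (norm x)\<^sup>2" for x
    by (simp add: defect_op_square[OF assms] inner_diff_right inner_cadjoint_right[OF A, symmetric]
        power2_norm_eq_inner)
  then have "norm (defect_op A x) \<le> norm x" for x
    by (simp add: power2_le_iff_abs_le)
  then show ?thesis
    using nonneg_opD(1)[OF nonneg_defect_op[OF assms]] by (simp add: contraction_iff)
qed

text \<open>A intertwines A* A with A A*, and therefore also the roots of I - A* A and of I - A
  A*.\<close>

lemma defect_op_commute:
  assumes "contraction A"
  shows "A (defect_op A x) = defect_op (cadjoint A) (A x)"
proof -
  have A: "bounded_clinear A"
    using assms by (simp add: contraction_def)
  show ?thesis
    unfolding defect_op_def
    by (rule op_sqrt_intertwine[OF contraction_gram[OF assms] contraction_gram[OF contraction_cadjoint[OF assms]] A])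
      (simp add: cadjoint_cadjoint[OF A])
qed

section \<open>Schur complements\<close>

text \<open>
  For \<open>P = A A*\<close> the map \<open>P\<^bsup>1/2\<^esup> x \<mapsto> A* x\<close> is isometric, so the operator \<open>P\<^bsup>-1/2\<^esup> A Z\<close> is \<open>J* Z\<close>
  for its continuous extension \<open>J\<close>, and \<open>J J*\<close> fixes the range of \<open>Z\<close>.
\<close>

lemma
  fixes A :: "'c::complex_hilbert \<Rightarrow> 'a::complex_hilbert" and Z :: "'b::complex_hilbert \<Rightarrow> 'c"
  assumes A: "contraction A" and Z: "bounded_clinear Z"
    and ker: "\<And>w h. A w = 0 \<Longrightarrow> inner w (Z h) = 0"
    and P_def: "P = (\<lambda>x. A (cadjoint A x))" and F_def: "F = (\<lambda>h. A (Z h))"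
  shows nonneg_op_gram: "nonneg_op P"
    and is_inv_sqrt_mult_unique: "\<exists>!R. is_inv_sqrt_mult P F R"
    and bounded_clinear_inv_sqrt_mult: "bounded_clinear (inv_sqrt_mult P F)"
    and range_subset_range_op_sqrt: "range F \<subseteq> range (op_sqrt P)"
    and inv_sqrt_mult_gram:
      "cadjoint (inv_sqrt_mult P F) (inv_sqrt_mult P F h) = cadjoint Z (Z h)"
proof -
  define C where "C = cadjoint A"
  have cA: "bounded_clinear A"
    using A by (simp add: contraction_def)
  have C: "contraction C"
    unfolding C_def by (rule contraction_cadjoint[OF A])
  then have cC: "bounded_clinear C"
    by (simp add: contraction_def)
  have C_adj: "cadjoint C = A"
    by (simp add: C_def cadjoint_cadjoint[OF cA])
  have P: "P = (\<lambda>x. A (C x))"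
    by (simp add: P_def C_def)
  have P_sa: "cadjoint P = P"
    using contraction_gram(2)[OF C] by (simp add: C_adj P)
  have cP: "bounded_clinear P"
    unfolding P by (rule bounded_clinear_compose[OF cA cC])
  note DC = contraction_defect_op[OF C] nonneg_op_selfadjoint[OF nonneg_defect_op[OF C]]
  have cDC: "bounded_clinear (defect_op C)"
    using DC(1) by (simp add: contraction_def)
  \<comment> \<open>As C = A*, the operator P = A A* equals I - X with X the square of the defect
    operator of C. This is the form for which square roots were constructed.\<close>
  define X where "X x = defect_op C (defect_op C x)" for x
  have X: "contraction X" "cadjoint X = X"
    using contraction_gram[OF DC(1)] by (simp_all add: DC(2) X_def[abs_def])
  have PX: "P = (\<lambda>x. x - X x)"
    by (simp add: X_def defect_op_square[OF C] C_adj P)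
  define B where "B = op_sqrt P"
  have B: "nonneg_op B"
    using op_sqrt_properties(1)[OF X] by (simp only: B_def PX)
  have BB: "B (B x) = A (C x)" for x
  proof -
    have "B (B x) = x - X x"
      using op_sqrt_properties(2)[OF X, of x] by (simp only: B_def PX)
    also have "\<dots> = P x"
      by (simp only: PX)
    finally show ?thesis
      by (simp only: P)
  qed
  note cB = nonneg_opD(1)[OF B]
  note linB = bounded_clinear_simps[OF cB]
  have inner_B: "inner (B x) y = inner x (B y)" for x y
    by (rule nonneg_op_inner_commute[OF B])
  have BC: "inner (B x) (B y) = inner (C x) (C y)" for x y
    by (simp add: inner_B BB inner_cadjoint_right[OF cC] C_adj)
  have norm_BC: "norm (B x) = norm (C x)" for x
    by (simp add: norm_eq_sqrt_inner BC)
  \<comment> \<open>P = B^2 and B are self-adjoint with the same kernel, so their ranges have the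
    same closure. The range condition in \<open>is_inv_sqrt_mult\<close> can thus be tested on
    B.\<close>
  have P_zero: "P w = 0 \<longleftrightarrow> B w = 0" for w
  proof
    assume "P w = 0"
    then have "inner (B w) (B w) = 0"
      by (simp add: inner_B BB) (simp add: P)
    then show "B w = 0" by simp
  qed (simp add: P linB flip: BB)
  have clB: "y \<in> closure (range B) \<longleftrightarrow> (\<forall>w. B w = 0 \<longrightarrow> inner w y = 0)" for y
    using in_closure_range_iff[OF cB] by (simp add: nonneg_op_selfadjoint[OF B])
  have clP: "closure (range P) = closure (range B)"
    using in_closure_range_iff[OF cP] by (auto simp: clB P_sa P_zero)
  \<comment> \<open>B is injective on its closed range, which is orthogonal to its kernel.\<close>
  have uniq: "u = v" if "u \<in> closure (range B)" "v \<in> closure (range B)" "B u = B v" for u v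
  proof -
    have "inner (u - v) (u - v) = 0"
      using that by (simp add: clB linB inner_diff_right)
    then show ?thesis by simp
  qed
  \<comment> \<open>R h is the Riesz vector of B x |-> inner (C x) (Z h), a bounded functional
    because norm (B x) = norm (C x).\<close>
  have "\<exists>r\<in>closure (range B). \<forall>x. inner (C x) (Z h) = inner (B x) r" for h
  proof (rule riesz_representation_range[where M = "norm (Z h)"])
    show "linear B"
      by (rule bounded_clinear_linear[OF cB])
    show "linear (\<lambda>x. inner (C x) (Z h))"
      by (rule linearI)
        (simp_all add: bounded_clinear_add[OF cC] bounded_clinear_scaleR[OF cC] inner_add_left)
    show "\<bar>inner (C x) (Z h)\<bar> \<le> norm (Z h) * norm (B x)" for x
      using Cauchy_Schwarz_ineq2[of "C x" "Z h"] by (simp add: norm_BC mult.commute)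
  qed
  then obtain R where R_cl: "\<And>h. R h \<in> closure (range B)"
    and R: "\<And>h x. inner (C x) (Z h) = inner (B x) (R h)"
    by metis
  have BR: "B (R h) = F h" for h
  proof -
    have "inner (B (R h) - F h) (B (R h)) = inner (B (R h) - F h) (F h)"
      by (simp add: inner_B[symmetric] R[symmetric] F_def inner_cadjoint_right[OF cC] C_adj)
    then have "inner (B (R h) - F h) (B (R h) - F h) = 0"
      by (simp add: inner_diff_right)
    then show ?thesis by simp
  qed
  have is_R: "is_inv_sqrt_mult P F R' \<longleftrightarrow> R' = R" for R'
  proof
    assume *: "is_inv_sqrt_mult P F R'"
    show "R' = R"
    proof (rule ext, rule uniq)
      fix h
      show "R' h \<in> closure (range B)"
        using * unfolding is_inv_sqrt_mult_def clP by blast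
      show "B (R' h) = B (R h)"
        using * unfolding is_inv_sqrt_mult_def B_def[symmetric] BR by blast
    qed (rule R_cl)
  next
    assume "R' = R"
    then show "is_inv_sqrt_mult P F R'"
      unfolding is_inv_sqrt_mult_def clP B_def[symmetric] by (simp add: BR image_subset_iff R_cl)
  qed
  then have inv: "inv_sqrt_mult P F = R"
    by (simp add: inv_sqrt_mult_def)
  have RZ: "inner (R h) (R k) = inner (Z h) (Z k)" for h k
  proof -
    \<comment> \<open>The kernel hypothesis puts Z h into the closed range of C. If C (x n) tends to
      Z h, then the vectors B (x n), having the same mutual distances, are Cauchy, and their limit
      must be R h; the inner products agree in the limit.\<close>
    have "Z h \<in> closure (range C)"
      using ker by (auto simp: in_closure_range_iff[OF cC] C_adj)
    then obtain u where "\<And>n. u n \<in> range C" and u: "u \<longlonglongrightarrow> Z h"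
      unfolding closure_sequential by blast
    then have "\<forall>n. \<exists>x. u n = C x"
      by blast
    from choice[OF this] obtain x where x: "\<And>n. u n = C (x n)"
      by blast
    have "dist (B (x n)) (B (x m)) = dist (C (x n)) (C (x m))" for n m
      by (simp add: dist_norm norm_BC flip: bounded_clinear_diff[OF cB] bounded_clinear_diff[OF cC])
    moreover have "Cauchy (\<lambda>n. C (x n))"
      using LIMSEQ_imp_Cauchy[OF u] by (simp add: x[abs_def])
    ultimately have "Cauchy (\<lambda>n. B (x n))"
      by (simp add: Cauchy_def)
    then obtain r where r: "(\<lambda>n. B (x n)) \<longlonglongrightarrow> r"
      using Cauchy_convergent_iff convergent_def by blast
    have "r \<in> closure (range B)"
      unfolding closure_sequential by (intro exI[of _ "\<lambda>n. B (x n)"] conjI allI r rangeI)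
    moreover have "B r = B (R h)"
    proof (rule LIMSEQ_unique)
      show "(\<lambda>n. B (B (x n))) \<longlonglongrightarrow> B r"
        using cB by (intro bounded_linear.tendsto[OF _ r]) (simp add: bounded_clinear_def)
      have "(\<lambda>n. A (u n)) \<longlonglongrightarrow> A (Z h)"
        using cA by (intro bounded_linear.tendsto[OF _ u]) (simp add: bounded_clinear_def)
      then show "(\<lambda>n. B (B (x n))) \<longlonglongrightarrow> B (R h)"
        by (simp add: BB BR x F_def)
    qed
    ultimately have r_eq: "r = R h"
      by (rule uniq[OF _ R_cl])
    show ?thesis
    proof (rule LIMSEQ_unique)
      show "(\<lambda>n. inner (B (x n)) (R k)) \<longlonglongrightarrow> inner (R h) (R k)"
        by (intro tendsto_inner tendsto_const r[unfolded r_eq])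
      have "(\<lambda>n. inner (u n) (Z k)) \<longlonglongrightarrow> inner (Z h) (Z k)"
        by (intro tendsto_inner tendsto_const u)
      then show "(\<lambda>n. inner (B (x n)) (R k)) \<longlonglongrightarrow> inner (Z h) (Z k)"
        by (simp add: x R)
    qed
  qed
  have F: "bounded_clinear F"
    unfolding F_def by (rule bounded_clinear_compose[OF cA Z])
  have cR: "bounded_clinear R"
  proof -
    have add: "R (h + k) = R h + R k" for h k
    proof (rule uniq)
      show "R h + R k \<in> closure (range B)"
        using R_cl[of h] R_cl[of k] by (simp add: clB inner_add_right)
    qed (simp_all add: R_cl BR linB bounded_clinear_add[OF F])
    have scaleC: "R (c *\<^sub>C h) = c *\<^sub>C R h" for c h
    proof (rule uniq)
      show "c *\<^sub>C R h \<in> closure (range B)"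
        using R_cl[of h] by (simp add: clB linB inner_scaleC_right)
    qed (simp_all add: R_cl BR linB bounded_clinear_scaleC[OF F])
    obtain M where M: "\<And>h. norm (Z h) \<le> norm h * M"
      using Z bounded_linear.bounded unfolding bounded_clinear_def by blast
    have "bounded_linear R"
    proof (rule bounded_linear_intro[where K = M])
      show "norm (R h) \<le> norm h * M" for h
        using M[of h] by (simp add: norm_eq_sqrt_inner RZ)
    qed (simp_all add: add scaleR_scaleC scaleC)
    with scaleC show ?thesis
      by (simp add: bounded_clinear_def)
  qed
  show "nonneg_op P"
    unfolding nonneg_op_def
  proof (intro allI conjI cP)
    fix x
    have "cinner (P x) x = cinner (C x) (C x)"
      by (simp add: P C_adj[symmetric] cinner_cadjoint_left[OF cC])
    then show "cinner (P x) x \<in> \<real>" "0 \<le> Re (cinner (P x) x)"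
      by (simp_all add: cinner_self_real)
  qed
  show "\<exists>!R. is_inv_sqrt_mult P F R"
    by (simp add: is_R)
  show "bounded_clinear (inv_sqrt_mult P F)"
    by (simp add: inv cR)
  show "range F \<subseteq> range (op_sqrt P)"
    unfolding B_def[symmetric] by (auto simp flip: BR)
  show "cadjoint (inv_sqrt_mult P F) (inv_sqrt_mult P F h) = cadjoint Z (Z h)"
  proof -
    define d where "d = cadjoint R (R h) - cadjoint Z (Z h)"
    have "inner d (cadjoint R (R h)) = inner d (cadjoint Z (Z h))"
      by (simp add: RZ flip: inner_cadjoint_right[OF cR] inner_cadjoint_right[OF Z])
    moreover have "inner d d = inner d (cadjoint R (R h)) - inner d (cadjoint Z (Z h))"
      by (simp only: inner_diff_right[symmetric] d_def)
    ultimately have "inner d d = 0"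
      by simp
    then show ?thesis
      by (simp add: inv d_def)
  qed
qed

section \<open>Factorisation and Schur complement of a two by two block operator\<close>

lemma cadjoint_block_op:
  assumes "bounded_clinear A11" "bounded_clinear A12" "bounded_clinear A21" "bounded_clinear A22"
  shows "cadjoint (block_op A11 A12 A21 A22) =
    block_op (cadjoint A11) (cadjoint A21) (cadjoint A12) (cadjoint A22)"
proof (rule cadjoint_eqI)
  show "cinner (block_op A11 A12 A21 A22 x) y =
    cinner x (block_op (cadjoint A11) (cadjoint A21) (cadjoint A12) (cadjoint A22) y)" for x y
    using assms by (cases x; cases y)
      (simp add: block_op_def cinner_prod_def cinner_add_left cinner_add_right cinner_cadjoint_right)
qed

text \<open>
  The entry \<open>X\<close> is \<open>- V T U + D\<^bsub>V*\<^esub> K D\<^sub>U\<close>, rewritten in terms of \<open>L = K + \<omega> Q\<close>.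
\<close>

lemma schur_complement:
  fixes T :: "'a::complex_hilbert \<Rightarrow> 'a" and V :: "'a \<Rightarrow> 'b::complex_hilbert" and U :: "'b \<Rightarrow> 'a"
    and L X :: "'b \<Rightarrow> 'b" and S :: "'a \<times> 'b \<Rightarrow> 'a \<times> 'b" and \<omega> :: complex
  assumes T: "contraction T" "cadjoint T = T"
    and V: "contraction V" "ker_op (defect_op T) \<subseteq> ker_op V"
    and U: "contraction U" "ker_op (defect_op T) \<subseteq> ker_op (cadjoint U)"
    and L: "bounded_clinear L" "ker_op (defect_op U) \<subseteq> ker_op L"
    and \<omega>: "cnj \<omega> = - \<omega>"
    and X_def: "X = (\<lambda>h. - V (T (U h)) + defect_op (cadjoint V) (L (defect_op U h)) - \<omega> *\<^sub>C (h - V (U h)))"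
    and S_def: "S = (\<lambda>x. x - block_op T (defect_op T \<circ> U) (V \<circ> defect_op T) X
          (cadjoint (block_op T (defect_op T \<circ> U) (V \<circ> defect_op T) X) x)
        + \<omega> *\<^sub>C (block_op T (defect_op T \<circ> U) (V \<circ> defect_op T) X x
          - cadjoint (block_op T (defect_op T \<circ> U) (V \<circ> defect_op T) X) x))"
  shows schur_block11: "block11 S =
      (\<lambda>x. defect_op T (defect_op (cadjoint U) (defect_op (cadjoint U) (defect_op T x))))"
    and schur_nonneg: "nonneg_op (block11 S)"
    and schur_range: "range (block12 S) \<subseteq> range (op_sqrt (block11 S))"
    and schur_unique: "\<exists>!R. is_inv_sqrt_mult (block11 S) (block12 S) R"
    and schur_bounded: "bounded_clinear (inv_sqrt_mult (block11 S) (block12 S))"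
    and schur_complement_eq: "block22 S h - cadjoint (inv_sqrt_mult (block11 S) (block12 S))
          (inv_sqrt_mult (block11 S) (block12 S) h)
        = (1 - \<omega>\<^sup>2) *\<^sub>C defect_op (cadjoint V) (defect_op (cadjoint V) h)
          - defect_op (cadjoint V) (L (cadjoint L (defect_op (cadjoint V) h)))"
proof -
  define D where "D = defect_op T"
  define Us where "Us = cadjoint U"
  define Vs where "Vs = cadjoint V"
  define Ls where "Ls = cadjoint L"
  define DU where "DU = defect_op U"
  define DUs where "DUs = defect_op Us"
  define DV where "DV = defect_op Vs"
  note folds = D_def[symmetric] Us_def[symmetric] Vs_def[symmetric] Ls_def[symmetric]
    DU_def[symmetric] DUs_def[symmetric] DV_def[symmetric]
  have cT: "bounded_clinear T" and cV: "bounded_clinear V" and cU: "bounded_clinear U"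
    using T V U by (simp_all add: contraction_def)
  have contr: "contraction Us" "contraction Vs"
    unfolding Us_def Vs_def by (intro contraction_cadjoint V U)+
  have adj: "cadjoint Us = U" "cadjoint Vs = V" "cadjoint Ls = L"
    unfolding Us_def Vs_def Ls_def by (intro cadjoint_cadjoint cU cV L)+
  have cont_D: "contraction D" "contraction DUs"
    unfolding D_def DUs_def by (intro contraction_defect_op T contr)+
  have nonneg: "nonneg_op D" "nonneg_op DU" "nonneg_op DUs" "nonneg_op DV"
    unfolding D_def DU_def DUs_def DV_def by (intro nonneg_defect_op T U contr)+
  note sa = nonneg[THEN nonneg_op_selfadjoint]
  have bc: "bounded_clinear Us" "bounded_clinear Vs" "bounded_clinear Ls"
    "bounded_clinear D" "bounded_clinear DU" "bounded_clinear DUs" "bounded_clinear DV"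
    unfolding Us_def Vs_def Ls_def
    using nonneg[THEN nonneg_opD(1)] cU cV L(1) by (simp_all add: bounded_clinear_cadjoint)
  note bc = bc cT cV cU L(1)
  have X: "X = (\<lambda>h. - V (T (U h)) + DV (L (DU h)) - \<omega> *\<^sub>C (h - V (U h)))"
    by (simp add: X_def folds)
  have cX: "bounded_clinear X"
    unfolding X by (intro bounded_clinear_intros bc[THEN bounded_clinear_compose])
  define Xs where "Xs = cadjoint X"
  have cXs: "bounded_clinear Xs"
    unfolding Xs_def by (rule bounded_clinear_cadjoint[OF cX])
  note right = bc[THEN cinner_cadjoint_right, unfolded sa adj T(2) folds]
  have Xs: "Xs = (\<lambda>h. - Us (T (Vs h)) + DU (Ls (DV h)) + \<omega> *\<^sub>C (h - Us (Vs h)))"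
    unfolding Xs_def X
    by (rule cadjoint_eqI)
      (simp add: right \<omega> cinner_add_left cinner_add_right cinner_diff_left cinner_diff_right
        cinner_scaleC_left cinner_scaleC_right)
  have DD: "D (D x) = x - T (T x)" for x
    by (simp add: D_def defect_op_square[OF T(1)] T(2))
  have DUDU: "DU (DU x) = x - Us (U x)" for x
    by (simp add: DU_def Us_def defect_op_square[OF U(1)])
  have DUsDUs: "DUs (DUs x) = x - U (Us x)" for x
    by (simp add: DUs_def defect_op_square[OF contr(1)] adj)
  have DVDV: "DV (DV x) = x - V (Vs x)" for x
    by (simp add: DV_def defect_op_square[OF contr(2)] adj)
  have UsU: "Us (U x) = x - DU (DU x)" for x
    by (simp add: DUDU)
  have TD: "T (D x) = D (T x)" for x
    using defect_op_commute[OF T(1)] by (simp add: T(2) D_def)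
  have DUsU: "DUs (U x) = U (DU x)" for x
    using defect_op_commute[OF U(1)] by (simp add: DUs_def DU_def Us_def)
  have UsDUs: "Us (DUs x) = DU (Us x)" for x
    using defect_op_commute[OF contr(1)] by (simp add: DUs_def DU_def adj)
  \<comment> \<open>Solved for the terms in L, these two turn mixed products back into X and its
    adjoint, which then stay opaque.\<close>
  have DVLDU: "DV (L (DU y)) = X y + V (T (U y)) + \<omega> *\<^sub>C (y - V (U y))" for y
    by (simp add: X)
  have DULsDV: "DU (Ls (DV y)) = Xs y + Us (T (Vs y)) - \<omega> *\<^sub>C (y - Us (Vs y))" for y
    by (simp add: Xs)
  note lin = bc[THEN bounded_clinear_add] bc[THEN bounded_clinear_diff] bc[THEN bounded_clinear_minus]
    bc[THEN bounded_clinear_zero] bc[THEN bounded_clinear_scaleC] bounded_clinear_simps[OF cX]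
    bounded_clinear_simps[OF cXs] scaleC_add_right scaleC_diff_right scaleC_scaleC

  define A where "A y = D (DUs y)" for y
  define Z where "Z h = - (DUs (T (Vs h) + \<omega> *\<^sub>C Vs h) + U (Ls (DV h)))" for h
  define Zs where "Zs y = - (V (T (DUs y)) - \<omega> *\<^sub>C V (DUs y) + DV (L (Us y)))" for y
  have A: "contraction A"
  proof -
    have "norm (D (DUs y)) \<le> norm y" for y
      using cont_D by (meson contraction_iff order_trans)
    moreover have "bounded_clinear A"
      unfolding A_def[abs_def] by (intro bounded_clinear_intros bc[THEN bounded_clinear_compose])
    ultimately show ?thesis
      by (simp add: contraction_iff A_def)
  qed
  have As: "cadjoint A = (\<lambda>x. DUs (D x))"
    by (rule cadjoint_eqI) (simp add: A_def right)
  have cZ: "bounded_clinear Z"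
    unfolding Z_def[abs_def] by (intro bounded_clinear_intros bc[THEN bounded_clinear_compose])
  have Zs: "cadjoint Z = Zs"
    by (rule cadjoint_eqI)
      (simp add: Z_def Zs_def right \<omega> cinner_add_left cinner_add_right
        cinner_diff_left cinner_diff_right lin
        cinner_scaleC_left cinner_scaleC_right)
  \<comment> \<open>T commutes with D and so preserves its kernel. Thus \<open>DUs w\<close> and
    \<open>T (DUs w)\<close> lie in the kernel of D, where V and Us vanish. From DU (Us w) = Us (DUs
    w) = 0 also L (Us w) = 0, so every term of \<open>Zs w\<close> is zero.\<close>
  have ker: "inner w (Z h) = 0" if "A w = 0" for w h
  proof -
    have Dw: "D (DUs w) = 0" "D (T (DUs w)) = 0"
      using that TD[of "DUs w"] by (simp_all add: A_def lin)
    then have "V (DUs w) = 0" "V (T (DUs w)) = 0" "Us (DUs w) = 0"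
      using V(2) U(2) by (auto simp: ker_op_def folds)
    then have "DU (Us w) = 0"
      by (simp add: UsDUs)
    then have "L (Us w) = 0"
      using L(2) by (auto simp: ker_op_def folds)
    then have "Zs w = 0"
      by (simp add: Zs_def \<open>V (DUs w) = 0\<close> \<open>V (T (DUs w)) = 0\<close> lin)
    then show ?thesis
      using inner_cadjoint_left[OF cZ, of w h] by (simp add: Zs)
  qed

  have cDU: "bounded_clinear (D \<circ> U)" "bounded_clinear (V \<circ> D)"
    unfolding comp_def by (intro bounded_clinear_intros bc[THEN bounded_clinear_compose])+
  have "cadjoint (D \<circ> U) = Us \<circ> D" "cadjoint (V \<circ> D) = D \<circ> Vs"
    by (rule cadjoint_eqI, simp add: right)+
  then have TKs: "cadjoint (block_op T (D \<circ> U) (V \<circ> D) X) = block_op T (D \<circ> Vs) (Us \<circ> D) Xs"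
    by (simp add: cadjoint_block_op cT cX cDU T(2) Xs_def)
  note S = S_def[folded D_def, unfolded TKs]
  \<comment> \<open>As T is self-adjoint, the term with \<omega> has no upper left entry; what is
    left is D (I - U Us) D.\<close>
  have S11: "block11 S = (\<lambda>x. D (DUs (DUs (D x))))"
    by (rule ext) (simp add: S block11_def block_op_def scaleC_prod_def lin DUsDUs DD)
  then have S11_A: "block11 S = (\<lambda>x. A (cadjoint A x))"
    by (simp add: A_def As)
  have S12: "block12 S = (\<lambda>h. A (Z h))"
    by (rule ext) (simp add: S block12_def block_op_def scaleC_prod_def lin A_def Z_def DUsDUs DUsU
      DULsDV TD)
  have S22: "block22 S h = h - (V (D (D (Vs h))) + X (Xs h)) + \<omega> *\<^sub>C (X h - Xs h)"
    by (simp add: S block22_def block_op_def scaleC_prod_def lin)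
  note inv = A cZ ker S11_A S12
  show "block11 S =
      (\<lambda>x. defect_op T (defect_op (cadjoint U) (defect_op (cadjoint U) (defect_op T x))))"
    using S11 by (simp add: folds)
  show "nonneg_op (block11 S)"
    by (rule nonneg_op_gram[OF inv])
  show "range (block12 S) \<subseteq> range (op_sqrt (block11 S))"
    by (rule range_subset_range_op_sqrt[OF inv])
  show "\<exists>!R. is_inv_sqrt_mult (block11 S) (block12 S) R"
    by (rule is_inv_sqrt_mult_unique[OF inv])
  show "bounded_clinear (inv_sqrt_mult (block11 S) (block12 S))"
    by (rule bounded_clinear_inv_sqrt_mult[OF inv])
  \<comment> \<open>The terms in X and Xs match those of \<open>block22 S\<close> and cancel in the
    difference. The rest collects to (1 - \<omega>^2) (I - V Vs) minus the term in L.\<close>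
  have "Zs (Z h) = V (T (T (Vs h))) - (\<omega> * \<omega>) *\<^sub>C V (Vs h) + DV (L (Ls (DV h)))
      - X (Xs h) + \<omega> *\<^sub>C (X h - Xs h) + (\<omega> * \<omega>) *\<^sub>C h"
    by (simp add: Zs_def Z_def lin DUsDUs DUsU UsDUs UsU DVLDU DULsDV)
  then have "block22 S h - Zs (Z h) = (1 - \<omega>\<^sup>2) *\<^sub>C DV (DV h) - DV (L (Ls (DV h)))"
    by (simp add: S22 DD DVDV lin scaleC_diff_left power2_eq_square)
  then show "block22 S h - cadjoint (inv_sqrt_mult (block11 S) (block12 S))
          (inv_sqrt_mult (block11 S) (block12 S) h)
        = (1 - \<omega>\<^sup>2) *\<^sub>C defect_op (cadjoint V) (defect_op (cadjoint V) h)
          - defect_op (cadjoint V) (L (cadjoint L (defect_op (cadjoint V) h)))"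
    by (simp only: inv_sqrt_mult_gram[OF inv, of h] Zs folds)
qed

section \<open>Extensions of dual pairs\<close>

text \<open>The kernel of the self-adjoint A is orthogonal to its closed range, and an extension by
  zero vanishes there. Real orthogonality to s and to \<open>\<i> *\<^sub>C s\<close> gives the
  complex one. This lemma and the next supply the kernel inclusions for K, Q and their
  adjoints.\<close>

lemma ops_between_ker:
  assumes Q: "Q \<in> ops_between (closure (range A)) S" and A: "nonneg_op A" and x: "A x = 0"
  shows "Q x = 0"
proof -
  note cA = nonneg_opD(1)[OF A]
  have "cinner x s = 0" if "s \<in> closure (range A)" for s
  proof -
    have "inner w s = 0" if "A w = 0" for w
      using that \<open>s \<in> closure (range A)\<close>
      by (simp add: in_closure_range_iff[OF cA] nonneg_op_selfadjoint[OF A])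
    then have "inner x s = 0" "inner x (\<i> *\<^sub>C s) = 0"
      by (simp_all add: inner_scaleC_right bounded_clinear_scaleC[OF cA] x bounded_clinear_minus[OF cA])
    then show ?thesis
      by (simp add: complex_eq_iff inner_scaleC_ii) (simp add: inner_eq_Re_cinner)
  qed
  then show ?thesis
    using Q by (simp add: ops_between_def)
qed

text \<open>Q Q* y lies in the closed range of B and is thus orthogonal to y, which makes norm (Q*
  y)^2 zero.\<close>

lemma ops_between_ker_cadjoint:
  assumes Q: "Q \<in> ops_between S (closure (range B))" and B: "nonneg_op B" and y: "B y = 0"
  shows "cadjoint Q y = 0"
proof -
  have cQ: "bounded_clinear Q" and "Q (cadjoint Q y) \<in> closure (range B)"
    using Q by (auto simp: ops_between_def)
  then have "inner y (Q (cadjoint Q y)) = 0"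
    using y by (simp add: in_closure_range_iff[OF nonneg_opD(1)[OF B]] nonneg_op_selfadjoint[OF B])
  then have "inner (cadjoint Q y) (cadjoint Q y) = 0"
    by (simp add: inner_cadjoint_left[OF cQ])
  then show ?thesis
    by simp
qed

lemma ops_between_diff:
  assumes "Q \<in> ops_between S (closure (range B))" "Q' \<in> ops_between S (closure (range B))"
    and B: "bounded_clinear B"
  shows "(\<lambda>x. Q x - Q' x) \<in> ops_between S (closure (range B))"
  using assms(1,2)
  by (auto simp: ops_between_def in_closure_range_iff[OF B] image_subset_iff inner_diff_right
      intro: bounded_clinear_sub)

text \<open>B is injective on its closed range, so E A = 0. Then A E* = 0, because norm (A E* w)^2 =
  inner (E A A E* w) w. Hence E* maps into the kernel of A, on which E vanishes, and E E* = 0.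
  Applied to a difference, this gives uniqueness of Q.\<close>

lemma ops_between_zero_if_sandwich_zero:
  assumes E: "E \<in> ops_between (closure (range A)) (closure (range B))"
    and A: "nonneg_op A" and B: "nonneg_op B" and BEA: "\<And>h. B (E (A h)) = 0"
  shows "E x = 0"
proof -
  have cE: "bounded_clinear E"
    using E by (simp add: ops_between_def)
  have EA: "E (A h) = 0" for h
  proof -
    have "E (A h) \<in> closure (range B)"
      using E by (auto simp: ops_between_def)
    then have "inner (E (A h)) (E (A h)) = 0"
      using BEA[of h]
      by (simp add: in_closure_range_iff[OF nonneg_opD(1)[OF B]] nonneg_op_selfadjoint[OF B])
    then show ?thesis
      by simp
  qed
  have "cadjoint E w = 0" for w
  proof -
    have "inner (A (cadjoint E w)) (A (cadjoint E w)) = inner (E (A (A (cadjoint E w)))) w"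
      using nonneg_op_inner_commute[OF A, of "A (cadjoint E w)" "cadjoint E w"]
        inner_cadjoint_right[OF cE, of "A (A (cadjoint E w))" w] by simp
    then have "A (cadjoint E w) = 0"
      by (simp add: EA)
    then have "E (cadjoint E w) = 0"
      by (rule ops_between_ker[OF E A])
    then have "inner (cadjoint E w) (cadjoint E w) = 0"
      by (simp add: inner_cadjoint_left[OF cE])
    then show ?thesis
      by simp
  qed
  then have "inner (E x) (E x) = 0"
    by (simp add: inner_cadjoint_right[OF cE])
  then show ?thesis
    by simp
qed

section \<open>The operator Q\<close>

lemma is_Q_unique:
  assumes "contraction U" "contraction V" and Q: "is_Q U V Q" and Q': "is_Q U V Q'"
  shows "Q = Q'"
proof
  fix x
  note nn = nonneg_defect_op[OF assms(1)] nonneg_defect_op[OF contraction_cadjoint[OF assms(2)]]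
  have "(\<lambda>x. Q x - Q' x) \<in> ops_between (defect_space1 U) (defect_space2 V)"
    using Q Q' unfolding is_Q_def defect_space2_def by (intro ops_between_diff nonneg_opD(1)[OF nn(2)]) auto
  moreover have "defect_op (cadjoint V) (Q (defect_op U h) - Q' (defect_op U h)) = 0" for h
    using Q Q' by (simp add: is_Q_def bounded_clinear_diff[OF nonneg_opD(1)[OF nn(2)]])
  ultimately have "Q x - Q' x = 0"
    unfolding defect_space1_def defect_space2_def
    by (intro ops_between_zero_if_sandwich_zero[OF _ nn, of "\<lambda>x. Q x - Q' x"])
  then show "Q x = Q' x"
    by simp
qed

lemma is_Q_Q_op:
  assumes "contraction U" "contraction V" "Q0_bounded U V"
  shows "is_Q U V (Q_op U V)"
  using assms is_Q_unique[OF assms(1,2)] theI'[of "is_Q U V"]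
  unfolding Q_op_def Q0_bounded_def by auto

lemma Q_op_ops_between:
  assumes "contraction U" "contraction V"
  shows "Q_op U V \<in> ops_between (defect_space1 U) (defect_space2 V)"
proof (cases "Q0_bounded U V")
  case True
  then show ?thesis
    using is_Q_Q_op[OF assms] by (simp add: is_Q_def)
next
  case False
  have "(0::'a) \<in> closure (range (defect_op (cadjoint V)))"
    using closure_subset nonneg_opD(1)[OF nonneg_defect_op[OF contraction_cadjoint[OF assms(2)]]]
    by (metis bounded_clinear_zero rangeI subsetD)
  with False show ?thesis
    by (auto simp: Q_op_def ops_between_def defect_space2_def bounded_clinear_def)
qed

text \<open>The weight cot \<phi> merges the two cases: for unbounded Q_0, \<open>phi1\<close> is
  arccos 0, which forces \<phi> = pi/2 and cot \<phi> = 0.\<close>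

lemma cot_Q_op:
  assumes "contraction U" "contraction V" "phi1 U V \<le> \<phi>" "\<phi> \<le> pi / 2"
  shows "cot \<phi> *\<^sub>R (h - V (U h)) = cot \<phi> *\<^sub>R defect_op (cadjoint V) (Q_op U V (defect_op U h))"
proof (cases "Q0_bounded U V")
  case True
  then show ?thesis
    using is_Q_Q_op[OF assms(1,2)] by (simp add: is_Q_def)
next
  case False
  then have "\<phi> = pi / 2"
    using assms(3,4) by (simp add: phi1_def)
  then have "cot \<phi> = 0"
    by (simp only: cot_def cos_pi_half div_0)
  then show ?thesis
    by simp
qed

section \<open>Adjoint extensions and the identities for S and G\<close>

text \<open>This symmetry reduces G to S: taking adjoints stays within the same class of extensions,
  with V*, U*, K* in the places of U, V, K.\<close>

lemma cadjoint_dual_pair_extension: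
  assumes T: "contraction T" "cadjoint T = T" and V: "contraction V" and U: "contraction U"
    and K: "bounded_clinear K"
  shows "cadjoint (block_op T (defect_op T \<circ> U) (V \<circ> defect_op T)
      (\<lambda>h. - V (T (U h)) + defect_op (cadjoint V) (K (defect_op U h)))) =
    block_op T (defect_op T \<circ> cadjoint V) (cadjoint U \<circ> defect_op T)
      (\<lambda>h. - cadjoint U (T (cadjoint V h)) + defect_op U (cadjoint K (defect_op (cadjoint V) h)))"
proof -
  have contr: "bounded_clinear T" "bounded_clinear V" "bounded_clinear U"
    using assms by (simp_all add: contraction_def)
  have nonneg: "nonneg_op (defect_op T)" "nonneg_op (defect_op U)" "nonneg_op (defect_op (cadjoint V))"
    by (intro nonneg_defect_op contraction_cadjoint T V U)+
  note sa = nonneg[THEN nonneg_op_selfadjoint]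
  note bc = contr K nonneg[THEN nonneg_opD(1)]
  note right = bc[THEN cinner_cadjoint_right, unfolded sa T(2)]
  show ?thesis
    by (rule cadjoint_eqI)
      (auto simp: block_op_def cinner_prod_def cinner_add_left cinner_add_right
        cinner_diff_left cinner_diff_right right)
qed

text \<open>With \<omega> = \<sigma> \<i> cot \<phi> and L = K + \<omega> Q, one factor sin \<phi>
  turns L into the combination of K and Q with sin \<phi> and cos \<phi>, and sin^2 \<phi> cancels 1
  - \<omega>^2 = 1 / sin^2 \<phi>.\<close>

lemma extension_schur_complement:
  fixes T :: "'a::complex_hilbert \<Rightarrow> 'a" and V :: "'a \<Rightarrow> 'b::complex_hilbert" and U :: "'b \<Rightarrow> 'a"
    and K Q :: "'b \<Rightarrow> 'b" and S T\<^sub>K :: "'a \<times> 'b \<Rightarrow> 'a \<times> 'b" and \<sigma> \<phi> :: real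
  assumes T: "contraction T" "cadjoint T = T"
    and V: "contraction V" "ker_op (defect_op T) \<subseteq> ker_op V"
    and U: "contraction U" "ker_op (defect_op T) \<subseteq> ker_op (cadjoint U)"
    and K: "bounded_clinear K" "ker_op (defect_op U) \<subseteq> ker_op K"
    and Q: "bounded_clinear Q" "ker_op (defect_op U) \<subseteq> ker_op Q"
      "\<And>h. cot \<phi> *\<^sub>R (h - V (U h)) = cot \<phi> *\<^sub>R defect_op (cadjoint V) (Q (defect_op U h))"
    and \<sigma>: "\<sigma> \<in> {1, - 1}" and \<phi>: "sin \<phi> \<noteq> 0"
    and TK_def: "T\<^sub>K = block_op T (defect_op T \<circ> U) (V \<circ> defect_op T)
          (\<lambda>h. - V (T (U h)) + defect_op (cadjoint V) (K (defect_op U h)))"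
    and S_def: "S = (\<lambda>x. x - T\<^sub>K (cadjoint T\<^sub>K x)
          + (complex_of_real \<sigma> * \<i> * complex_of_real (cot \<phi>)) *\<^sub>C (T\<^sub>K x - cadjoint T\<^sub>K x))"
  shows extension_block11: "block11 S =
      (\<lambda>x. defect_op T (defect_op (cadjoint U) (defect_op (cadjoint U) (defect_op T x))))"
    and extension_nonneg: "nonneg_op (block11 S)"
    and extension_range: "range (block12 S) \<subseteq> range (op_sqrt (block11 S))"
    and extension_unique: "\<exists>!R. is_inv_sqrt_mult (block11 S) (block12 S) R"
    and extension_bounded: "bounded_clinear (inv_sqrt_mult (block11 S) (block12 S))"
    and extension_schur_eq: "(sin \<phi>)\<^sup>2 *\<^sub>R (block22 S h - cadjoint (inv_sqrt_mult (block11 S) (block12 S))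
          (inv_sqrt_mult (block11 S) (block12 S) h))
        = defect_op (cadjoint V) (defect_op (cadjoint V) h
          - (sin \<phi> *\<^sub>R K (sin \<phi> *\<^sub>R cadjoint K (defect_op (cadjoint V) h)
              - (complex_of_real \<sigma> * \<i> * complex_of_real (cos \<phi>)) *\<^sub>C cadjoint Q (defect_op (cadjoint V) h))
            + (complex_of_real \<sigma> * \<i> * complex_of_real (cos \<phi>)) *\<^sub>C
              Q (sin \<phi> *\<^sub>R cadjoint K (defect_op (cadjoint V) h)
              - (complex_of_real \<sigma> * \<i> * complex_of_real (cos \<phi>)) *\<^sub>C cadjoint Q (defect_op (cadjoint V) h))))"
proof -
  define \<omega> where "\<omega> = complex_of_real \<sigma> * \<i> * complex_of_real (cot \<phi>)"
  define L where "L x = K x + \<omega> *\<^sub>C Q x" for x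
  define DV where "DV = defect_op (cadjoint V)"
  have cDV: "bounded_clinear DV"
    unfolding DV_def by (intro nonneg_opD(1) nonneg_defect_op contraction_cadjoint V)
  have cL: "bounded_clinear L"
    unfolding L_def[abs_def] by (intro bounded_clinear_plus bounded_clinear_cmult K Q)
  have L_ker: "ker_op (defect_op U) \<subseteq> ker_op L"
    using K(2) Q(2) by (simp add: L_def ker_op_def Collect_mono_iff)
  have \<omega>: "cnj \<omega> = - \<omega>"
    by (simp add: \<omega>_def)
  have Ls: "cadjoint L = (\<lambda>x. cadjoint K x - \<omega> *\<^sub>C cadjoint Q x)"
    by (rule cadjoint_eqI)
      (simp add: L_def \<omega> cinner_add_left cinner_diff_right cinner_scaleC_left cinner_scaleC_right
        cinner_cadjoint_right[OF K(1)] cinner_cadjoint_right[OF Q(1)])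
  \<comment> \<open>I - V U enters \<open>schur_complement\<close> only through its multiple by
    \<omega>, so the relation weighted by cot \<phi> covers bounded and unbounded Q_0 alike.\<close>
  have \<omega>Q: "\<omega> *\<^sub>C (h - V (U h)) = \<omega> *\<^sub>C DV (Q (defect_op U h))" for h
  proof -
    have "\<omega> *\<^sub>C y = (complex_of_real \<sigma> * \<i>) *\<^sub>C (cot \<phi> *\<^sub>R y)" for y :: 'b
      by (simp add: \<omega>_def scaleR_scaleC scaleC_scaleC)
    then show ?thesis
      by (simp only: Q(3) DV_def)
  qed
  have "T\<^sub>K = block_op T (defect_op T \<circ> U) (V \<circ> defect_op T)
      (\<lambda>h. - V (T (U h)) + defect_op (cadjoint V) (L (defect_op U h)) - \<omega> *\<^sub>C (h - V (U h)))"
    unfolding \<omega>Q TK_def DV_def[symmetric] L_def bounded_clinear_simps[OF cDV] by simp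
  note schur = T V U cL L_ker \<omega> refl S_def[folded \<omega>_def, unfolded this]
  show "block11 S =
      (\<lambda>x. defect_op T (defect_op (cadjoint U) (defect_op (cadjoint U) (defect_op T x))))"
    by (rule schur_block11[OF schur])
  show "nonneg_op (block11 S)"
    by (rule schur_nonneg[OF schur])
  show "range (block12 S) \<subseteq> range (op_sqrt (block11 S))"
    by (rule schur_range[OF schur])
  show "\<exists>!R. is_inv_sqrt_mult (block11 S) (block12 S) R"
    by (rule schur_unique[OF schur])
  show "bounded_clinear (inv_sqrt_mult (block11 S) (block12 S))"
    by (rule schur_bounded[OF schur])
  define R where "R = inv_sqrt_mult (block11 S) (block12 S)"
  have eq: "block22 S h - cadjoint R (R h)
      = (1 - \<omega>\<^sup>2) *\<^sub>C DV (DV h) - DV (L (cadjoint L (DV h)))"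
    unfolding R_def DV_def by (rule schur_complement_eq[OF schur])
  have "\<omega>\<^sup>2 = - complex_of_real ((cot \<phi>)\<^sup>2)"
    using \<sigma> by (auto simp: \<omega>_def power_mult_distrib)
  then have "complex_of_real ((sin \<phi>)\<^sup>2) * (1 - \<omega>\<^sup>2) = complex_of_real ((sin \<phi>)\<^sup>2 * (1 + (cot \<phi>)\<^sup>2))"
    by simp
  also have "(sin \<phi>)\<^sup>2 * (1 + (cot \<phi>)\<^sup>2) = 1"
    using \<phi> by (simp add: cot_def power_divide distrib_left)
  finally have s1: "complex_of_real ((sin \<phi>)\<^sup>2) * (1 - \<omega>\<^sup>2) = 1"
    by simp
  have s2: "complex_of_real \<sigma> * \<i> * complex_of_real (cos \<phi>) = complex_of_real (sin \<phi>) * \<omega>"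
    using \<phi> by (simp add: \<omega>_def cot_def)
  have "(sin \<phi>)\<^sup>2 *\<^sub>R (block22 S h - cadjoint R (R h)) =
      DV (DV h) - (sin \<phi>)\<^sup>2 *\<^sub>R DV (L (cadjoint L (DV h)))"
    unfolding eq scaleR_diff_right scaleR_scaleC[of _ "_ *\<^sub>C _"] scaleC_scaleC s1 by simp
  also have "\<dots> = DV (DV h - sin \<phi> *\<^sub>R L (sin \<phi> *\<^sub>R cadjoint L (DV h)))"
    by (simp add: bounded_clinear_diff[OF cDV] bounded_clinear_scaleR[OF cDV]
        bounded_clinear_scaleR[OF cL] power2_eq_square)
  finally show "(sin \<phi>)\<^sup>2 *\<^sub>R (block22 S h - cadjoint (inv_sqrt_mult (block11 S) (block12 S))
          (inv_sqrt_mult (block11 S) (block12 S) h))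
        = defect_op (cadjoint V) (defect_op (cadjoint V) h
          - (sin \<phi> *\<^sub>R K (sin \<phi> *\<^sub>R cadjoint K (defect_op (cadjoint V) h)
              - (complex_of_real \<sigma> * \<i> * complex_of_real (cos \<phi>)) *\<^sub>C cadjoint Q (defect_op (cadjoint V) h))
            + (complex_of_real \<sigma> * \<i> * complex_of_real (cos \<phi>)) *\<^sub>C
              Q (sin \<phi> *\<^sub>R cadjoint K (defect_op (cadjoint V) h)
              - (complex_of_real \<sigma> * \<i> * complex_of_real (cos \<phi>)) *\<^sub>C cadjoint Q (defect_op (cadjoint V) h))))"
    by (simp add: R_def DV_def s2 L_def Ls scaleR_scaleC scaleC_add_right scaleC_diff_right scaleC_scaleC)
qed

theorem theorem4p1:
  fixes T1 T2 :: "'a::complex_hilbert \<Rightarrow> 'a \<times> 'b::complex_hilbert"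
    and T11 :: "'a \<Rightarrow> 'a" and T12 :: "'b \<Rightarrow> 'a" and T21 :: "'a \<Rightarrow> 'b"
    and V :: "'a \<Rightarrow> 'b" and U :: "'b \<Rightarrow> 'a"
    and K Q :: "'b \<Rightarrow> 'b" and \<phi> :: real
    and T\<^sub>K :: "'a \<times> 'b \<Rightarrow> 'a \<times> 'b"
    and S G :: "real \<Rightarrow> 'a \<times> 'b \<Rightarrow> 'a \<times> 'b"
    and S11 G11 :: "'a \<Rightarrow> 'a"
  assumes dual_pair: "dual_pair_symm_contractions T1 T2"
    and T11_def: "T11 = fst \<circ> T1"
    and T21_def: "T21 = snd \<circ> T1"
    and T12_def: "T12 = cadjoint (snd \<circ> T2)"
    and V: "contraction V" "T21 = V \<circ> defect_op T11" "ker_op (defect_op T11) \<subseteq> ker_op V"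
    and U: "contraction U" "T12 = defect_op T11 \<circ> U" "ker_op (defect_op T11) \<subseteq> ker_op (cadjoint U)"
    and Q_def: "Q = Q_op U V"
    and phi: "phi1 U V \<le> \<phi>" "\<phi> \<le> pi / 2" "0 < \<phi>"
    and K: "K \<in> ops_between (defect_space1 U) (defect_space2 V)"
    and TK_def: "T\<^sub>K = block_op T11 T12 T21
          (\<lambda>h. - V (T11 (U h)) + defect_op (cadjoint V) (K (defect_op U h)))"
    and S_def: "S = (\<lambda>\<sigma> x. x - T\<^sub>K (cadjoint T\<^sub>K x)
          + (complex_of_real \<sigma> * \<i> * complex_of_real (cot \<phi>)) *\<^sub>C (T\<^sub>K x - cadjoint T\<^sub>K x))"
    and G_def: "G = (\<lambda>\<sigma> x. x - cadjoint T\<^sub>K (T\<^sub>K x)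
          + (complex_of_real \<sigma> * \<i> * complex_of_real (cot \<phi>)) *\<^sub>C (T\<^sub>K x - cadjoint T\<^sub>K x))"
    and S11_def: "S11 = block11 (S 1)"
    and G11_def: "G11 = block11 (G 1)"
  shows "block11 (S 1) = block11 (S (- 1)) \<and> nonneg_op S11
    \<and> block11 (G 1) = block11 (G (- 1)) \<and> nonneg_op G11
    \<and> (\<forall>\<sigma>\<in>{1, - 1}.
        range (block12 (S \<sigma>)) \<subseteq> range (op_sqrt S11)
      \<and> range (block12 (G \<sigma>)) \<subseteq> range (op_sqrt G11)
      \<and> (\<exists>!R. is_inv_sqrt_mult S11 (block12 (S \<sigma>)) R)
      \<and> bounded_clinear (inv_sqrt_mult S11 (block12 (S \<sigma>)))
      \<and> (\<exists>!R. is_inv_sqrt_mult G11 (block12 (G \<sigma>)) R)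
      \<and> bounded_clinear (inv_sqrt_mult G11 (block12 (G \<sigma>))))
    \<and> (\<forall>\<sigma>\<in>{1, - 1}.
        let RS = inv_sqrt_mult S11 (block12 (S \<sigma>));
            RG = inv_sqrt_mult G11 (block12 (G \<sigma>));
            M = (\<lambda>h. sin \<phi> *\<^sub>R K h
                  + (complex_of_real \<sigma> * \<i> * complex_of_real (cos \<phi>)) *\<^sub>C Q h);
            N = (\<lambda>h. sin \<phi> *\<^sub>R cadjoint K h
                  - (complex_of_real \<sigma> * \<i> * complex_of_real (cos \<phi>)) *\<^sub>C cadjoint Q h);
            DV = defect_op (cadjoint V);
            DU = defect_op U
        in (\<forall>h. (sin \<phi>)\<^sup>2 *\<^sub>R (block22 (S \<sigma>) h - cadjoint RS (RS h))
                = DV (DV h - M (N (DV h))))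
         \<and> (\<forall>h. (sin \<phi>)\<^sup>2 *\<^sub>R (block22 (G \<sigma>) h - cadjoint RG (RG h))
                = DU (DU h - N (M (DU h)))))"
proof -
  have T11: "contraction T11" "cadjoint T11 = T11"
  proof -
    have T1: "bounded_clinear T1" "\<And>x. norm (T1 x) \<le> norm x"
      using dual_pair by (auto simp: dual_pair_symm_contractions_def contraction_iff)
    have "norm (T11 x) \<le> norm x" for x
      using T1(2)[of x] norm_fst_le[of "fst (T1 x)" "snd (T1 x)"] by (simp add: T11_def)
    moreover have "bounded_clinear T11"
      using T1(1) unfolding bounded_clinear_def T11_def comp_def
      by (auto simp: scaleC_prod_def intro: bounded_linear_fst_comp)
    ultimately show "contraction T11"
      by (simp add: contraction_iff)
    have "cinner (T1 f) (g, 0) = cinner (f, 0) (T1 g)" for f g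
      using dual_pair unfolding dual_pair_symm_contractions_def by blast
    then show "cadjoint T11 = T11"
      by (intro cadjoint_eqI) (simp add: T11_def cinner_prod_def)
  qed
  define Us where "Us = cadjoint U"
  define Vs where "Vs = cadjoint V"
  define Ks where "Ks = cadjoint K"
  define Qs where "Qs = cadjoint Q"
  have contr: "contraction Us" "contraction Vs"
    unfolding Us_def Vs_def by (intro contraction_cadjoint U V)+
  have UV: "bounded_clinear U" "bounded_clinear V"
    using U(1) V(1) by (simp_all add: contraction_def)
  have adj: "cadjoint Us = U" "cadjoint Vs = V"
    unfolding Us_def Vs_def by (intro cadjoint_cadjoint UV)+
  note nn = nonneg_defect_op[OF U(1)] nonneg_defect_op[OF contr(2), unfolded Vs_def]
  have Q: "Q \<in> ops_between (defect_space1 U) (defect_space2 V)"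
    unfolding Q_def by (rule Q_op_ops_between[OF U(1) V(1)])
  have cKQ: "bounded_clinear K" "bounded_clinear Q"
    using K Q by (simp_all add: ops_between_def)
  have cKQs: "bounded_clinear Ks" "bounded_clinear Qs"
    unfolding Ks_def Qs_def by (intro bounded_clinear_cadjoint cKQ)+
  have adjKQ: "cadjoint Ks = K" "cadjoint Qs = Q"
    unfolding Ks_def Qs_def by (intro cadjoint_cadjoint cKQ)+
  have ker: "ker_op (defect_op U) \<subseteq> ker_op K" "ker_op (defect_op U) \<subseteq> ker_op Q"
    using K Q ops_between_ker[OF _ nn(1)] by (auto simp: defect_space1_def ker_op_def)
  have kers: "ker_op (defect_op Vs) \<subseteq> ker_op Ks" "ker_op (defect_op Vs) \<subseteq> ker_op Qs"
    using K Q ops_between_ker_cadjoint[OF _ nn(2)]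
    by (auto simp: defect_space2_def ker_op_def Ks_def Qs_def Vs_def)
  have cot: "cot \<phi> *\<^sub>R (h - V (U h)) = cot \<phi> *\<^sub>R defect_op (cadjoint V) (Q (defect_op U h))" for h
    unfolding Q_def by (rule cot_Q_op[OF U(1) V(1) phi(1,2)])
  \<comment> \<open>The adjoint of the weighted relation for Q. Pairing \<open>cot\<close> at d with
    h shows that d, the difference of the two sides, is orthogonal to itself.\<close>
  have cot_s: "cot \<phi> *\<^sub>R (h - Us (Vs h)) = cot \<phi> *\<^sub>R defect_op (cadjoint Us) (Qs (defect_op Vs h))" for h
  proof -
    have bc: "bounded_clinear (defect_op U)" "bounded_clinear (defect_op Vs)"
      using nn by (simp_all add: nonneg_opD Vs_def)
    have sa: "cadjoint (defect_op U) = defect_op U" "cadjoint (defect_op Vs) = defect_op Vs"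
      using nn by (simp_all add: nonneg_op_selfadjoint Vs_def)
    note right = inner_cadjoint_right[OF UV(1)] inner_cadjoint_right[OF UV(2)]
      inner_cadjoint_right[OF cKQ(2)] bc[THEN inner_cadjoint_right, unfolded sa]
    define d where "d = cot \<phi> *\<^sub>R (h - Us (Vs h)) - cot \<phi> *\<^sub>R defect_op U (Qs (defect_op Vs h))"
    have "inner (cot \<phi> *\<^sub>R (d - V (U d))) h = inner (cot \<phi> *\<^sub>R defect_op Vs (Q (defect_op U d))) h"
      by (simp only: cot Vs_def)
    then have "inner d (cot \<phi> *\<^sub>R (h - Us (Vs h))) = inner d (cot \<phi> *\<^sub>R defect_op U (Qs (defect_op Vs h)))"
      by (simp add: inner_diff_left inner_diff_right right Us_def[symmetric] Vs_def[symmetric] Qs_def[symmetric])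
    then have "inner d d = 0"
      by (subst (2) d_def) (simp only: inner_diff_right)
    then show ?thesis
      by (simp add: d_def adj)
  qed
  have "0 < sin \<phi>"
    using phi pi_gt_zero by (intro sin_gt_zero) linarith+
  then have sin: "sin \<phi> \<noteq> 0"
    by simp
  have TK: "T\<^sub>K = block_op T11 (defect_op T11 \<circ> U) (V \<circ> defect_op T11)
      (\<lambda>h. - V (T11 (U h)) + defect_op (cadjoint V) (K (defect_op U h)))"
    by (simp only: TK_def U(2) V(2))
  have TKs: "cadjoint T\<^sub>K = block_op T11 (defect_op T11 \<circ> Vs) (Us \<circ> defect_op T11)
      (\<lambda>h. - Us (T11 (Vs h)) + defect_op (cadjoint Us) (Ks (defect_op Vs h)))"
    unfolding TK adj unfolding Us_def Vs_def Ks_def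
    by (rule cadjoint_dual_pair_extension[OF T11 V(1) U(1) cKQ(1)])
  \<comment> \<open>A second application of the adjoint formula restores the original
    parameters.\<close>
  have TKss: "cadjoint (cadjoint T\<^sub>K) = T\<^sub>K"
    by (rule trans[OF arg_cong[OF TKs, of cadjoint]
          trans[OF cadjoint_dual_pair_extension[OF T11 contr(1,2) cKQs(1)]]])
      (simp only: adj adjKQ TK Vs_def[symmetric])
  have kerUs: "ker_op (defect_op T11) \<subseteq> ker_op Us" and kerVs: "ker_op (defect_op T11) \<subseteq> ker_op (cadjoint Vs)"
    using U(3) V(3) by (simp_all add: Us_def adj)
  have S_eq: "S \<sigma> = (\<lambda>x. x - T\<^sub>K (cadjoint T\<^sub>K x)
      + (complex_of_real \<sigma> * \<i> * complex_of_real (cot \<phi>)) *\<^sub>C (T\<^sub>K x - cadjoint T\<^sub>K x))" for \<sigma>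
    by (simp add: S_def)
  \<comment> \<open>G for the extension is S for its adjoint. Exchanging the two operators reverses
    their difference, so the sign \<sigma> becomes - \<sigma>.\<close>
  have G_eq: "G \<sigma> = (\<lambda>x. x - cadjoint T\<^sub>K (cadjoint (cadjoint T\<^sub>K) x)
      + (complex_of_real (- \<sigma>) * \<i> * complex_of_real (cot \<phi>)) *\<^sub>C
        (cadjoint T\<^sub>K x - cadjoint (cadjoint T\<^sub>K) x))" for \<sigma>
    by (simp add: G_def TKss flip: scaleC_minus_right)
  have neg: "- \<sigma> \<in> {1, - 1::real}" if "\<sigma> \<in> {1, - 1}" for \<sigma>
    using that by auto
  note s = extension_schur_complement[OF T11 V(1,3) U(1,3) cKQ(1) ker(1) cKQ(2) ker(2) cot _ sin TK S_eq]
  note g = extension_schur_complement[OF T11 contr(1) kerUs contr(2) kerVs cKQs(1) kers(1) cKQs(2)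
      kers(2) cot_s neg sin TKs G_eq]
  have pm: "1 \<in> {1, - 1::real}" "- 1 \<in> {1, - 1::real}"
    by simp_all
  \<comment> \<open>The formula for the upper left block contains no \<sigma>, so both signs share
    it; the same holds for G.\<close>
  have S11: "block11 (S \<sigma>) = S11" if "\<sigma> \<in> {1, - 1}" for \<sigma>
    unfolding S11_def s(1)[OF that] s(1)[OF pm(1)] ..
  have G11: "block11 (G \<sigma>) = G11" if "\<sigma> \<in> {1, - 1}" for \<sigma>
    unfolding G11_def g(1)[OF that] g(1)[OF pm(1)] ..
  show ?thesis
    unfolding Let_def
  proof (intro conjI ballI allI)
    show "block11 (S 1) = block11 (S (- 1))" "block11 (G 1) = block11 (G (- 1))"
      by (simp_all only: S11[OF pm(1)] S11[OF pm(2)] G11[OF pm(1)] G11[OF pm(2)])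
    show "nonneg_op S11" "nonneg_op G11"
      unfolding S11_def G11_def by (rule s(2)[OF pm(1)], rule g(2)[OF pm(1)])
    fix \<sigma> :: real assume \<sigma>: "\<sigma> \<in> {1, - 1}"
    show "range (block12 (S \<sigma>)) \<subseteq> range (op_sqrt S11)"
      using s(3)[OF \<sigma>] by (simp only: S11[OF \<sigma>])
    show "range (block12 (G \<sigma>)) \<subseteq> range (op_sqrt G11)"
      using g(3)[OF \<sigma>] by (simp only: G11[OF \<sigma>])
    show "\<exists>!R. is_inv_sqrt_mult S11 (block12 (S \<sigma>)) R"
      using s(4)[OF \<sigma>] by (simp only: S11[OF \<sigma>])
    show "bounded_clinear (inv_sqrt_mult S11 (block12 (S \<sigma>)))"
      using s(5)[OF \<sigma>] by (simp only: S11[OF \<sigma>])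
    show "\<exists>!R. is_inv_sqrt_mult G11 (block12 (G \<sigma>)) R"
      using g(4)[OF \<sigma>] by (simp only: G11[OF \<sigma>])
    show "bounded_clinear (inv_sqrt_mult G11 (block12 (G \<sigma>)))"
      using g(5)[OF \<sigma>] by (simp only: G11[OF \<sigma>])
  next
    fix \<sigma> :: real and h :: 'b assume \<sigma>: "\<sigma> \<in> {1, - 1}"
    show "(sin \<phi>)\<^sup>2 *\<^sub>R (block22 (S \<sigma>) h - cadjoint (inv_sqrt_mult S11 (block12 (S \<sigma>)))
          (inv_sqrt_mult S11 (block12 (S \<sigma>)) h))
        = defect_op (cadjoint V) (defect_op (cadjoint V) h
          - (sin \<phi> *\<^sub>R K (sin \<phi> *\<^sub>R cadjoint K (defect_op (cadjoint V) h)
              - (complex_of_real \<sigma> * \<i> * complex_of_real (cos \<phi>)) *\<^sub>C cadjoint Q (defect_op (cadjoint V) h))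
            + (complex_of_real \<sigma> * \<i> * complex_of_real (cos \<phi>)) *\<^sub>C
              Q (sin \<phi> *\<^sub>R cadjoint K (defect_op (cadjoint V) h)
              - (complex_of_real \<sigma> * \<i> * complex_of_real (cos \<phi>)) *\<^sub>C cadjoint Q (defect_op (cadjoint V) h))))"
      using s(6)[OF \<sigma>] by (simp only: S11[OF \<sigma>])
    show "(sin \<phi>)\<^sup>2 *\<^sub>R (block22 (G \<sigma>) h - cadjoint (inv_sqrt_mult G11 (block12 (G \<sigma>)))
          (inv_sqrt_mult G11 (block12 (G \<sigma>)) h))
        = defect_op U (defect_op U h
          - (sin \<phi> *\<^sub>R cadjoint K (sin \<phi> *\<^sub>R K (defect_op U h)
              + (complex_of_real \<sigma> * \<i> * complex_of_real (cos \<phi>)) *\<^sub>C Q (defect_op U h))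
            - (complex_of_real \<sigma> * \<i> * complex_of_real (cos \<phi>)) *\<^sub>C
              cadjoint Q (sin \<phi> *\<^sub>R K (defect_op U h)
              + (complex_of_real \<sigma> * \<i> * complex_of_real (cos \<phi>)) *\<^sub>C Q (defect_op U h))))"
      \<comment> \<open>With - \<sigma> and all parameters replaced by adjoints, the two factors in
        \<open>g(6)\<close> are N and M, in that order.\<close>
      using g(6)[OF \<sigma>, of h] by (simp add: G11[OF \<sigma>] adj adjKQ flip: Ks_def Qs_def)
  qed
qed

end
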